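(* Let $1\ne w\in\mathbf{F}_k$ and suppose $w=u^d$ in $\mathbf{F}_k$ with $u$ primitive and $d\ge1$. Then for every integer $L\ge1$, as $n\to\infty$ the random variable $X_{w,L}^{(n)}$ converges in distribution to $$\sum_{h\in H(d,L)} h\,Z_{1/(Lh)},$$ where $H(d,L)=\{h>0:\ h\mid d\text{ and }\gcd(d/h,L)=1\}$ and the $Z_{1/(Lh)}$, $h\in H(d,L)$, are independent Poisson random variables with parameters $1/(Lh)$. In particular the limit distribution depends only on $d$ and $L$.
   Context: $\mathbf{F}_k$ is the free group on $g_1,\dots,g_k$. A word $w\in\mathbf{F}_k$ is called imprimitive if $w=v^e$ for some $v\in\mathbf{F}_k$ and $e\ge2$, and primitive otherwise. For $\sigma_1,\dots,\sigma_k\in S_n$, $w(\sigma_1,\dots,\sigma_k)\in S_n$ is obtained by substituting $\sigma_i$ for each occurrence of $g_i$ (and $\sigma_i^{-1}$ for $g_i^{-1}$) and composing. $X_{w,L}^{(n)}$ is the number of cycles of length $L$ of $w(\sigma_1,\dots,\sigma_k)$ where $\sigma_1,\dots,\sigma_k$ are independent uniformly random elements of $S_n$. *)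

theory Defs
  imports
    "HOL-Probability.Probability"
    "HOL-Algebra.Sym_Groups"
    "HOL-Combinatorics.Orbits"
begin

section \<open>Free groups as groups of reduced words\<close>

text \<open>
  The letter \<open>(i, True)\<close> stands for the generator \<open>g\<^sub>i\<close> and \<open>(i, False)\<close> for its inverse.
\<close>

type_synonym letter = "nat \<times> bool"

definition inv_letter :: "letter \<Rightarrow> letter" where
  "inv_letter a = (fst a, \<not> snd a)"

definition reduced :: "letter list \<Rightarrow> bool" where
  "reduced w \<longleftrightarrow> successively (\<lambda>a b. b \<noteq> inv_letter a) w"

text \<open>Left multiplication of a reduced word by a single letter, with cancellation.\<close>

fun cons_red :: "letter \<Rightarrow> letter list \<Rightarrow> letter list" where
  "cons_red a [] = [a]"
| "cons_red a (b # w) = (if b = inv_letter a then w else a # b # w)"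

definition free_group :: "nat \<Rightarrow> letter list monoid" where
  "free_group k =
     \<lparr> carrier = {w. set w \<subseteq> {1..k} \<times> UNIV \<and> reduced w},
       mult = (\<lambda>v w. foldr cons_red v w),
       one = [] \<rparr>"

lemma inv_letter_inv_letter [simp]: "inv_letter (inv_letter a) = a"
  by (simp add: inv_letter_def)

lemma inv_letter_neq [simp]: "inv_letter a \<noteq> a" "a \<noteq> inv_letter a"
  by (auto simp: inv_letter_def prod_eq_iff)

lemma fst_inv_letter [simp]: "fst (inv_letter a) = fst a"
  by (simp add: inv_letter_def)

lemma reduced_Nil [simp]: "reduced []"
  by (simp add: reduced_def)

lemma reduced_Cons:
  "reduced (a # w) \<longleftrightarrow> (w = [] \<or> hd w \<noteq> inv_letter a) \<and> reduced w"
  by (cases w) (auto simp: reduced_def)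

lemma reduced_cons_red: "reduced w \<Longrightarrow> reduced (cons_red a w)"
  by (cases w) (auto simp: reduced_Cons)

lemma reduced_foldr_cons_red: "reduced w \<Longrightarrow> reduced (foldr cons_red v w)"
  by (induction v) (auto intro: reduced_cons_red)

lemma set_foldr_cons_red: "set (foldr cons_red v w) \<subseteq> set v \<union> set w"
proof (induction v)
  case (Cons a v)
  have "set (cons_red a x) \<subseteq> insert a (set x)" for x
    by (cases x) auto
  with Cons show ?case by fastforce
qed simp

lemma foldr_cons_red_Nil: "reduced v \<Longrightarrow> foldr cons_red v [] = v"
proof (induction v)
  case (Cons a v)
  then show ?case by (cases v) (auto simp: reduced_Cons)
qed simp

lemma cons_red_cancel:
  assumes "reduced w"
  shows "cons_red a (cons_red (inv_letter a) w) = w"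
  using assms by (cases w; cases "tl w") (auto simp: reduced_Cons)

lemma foldr_cons_red_cons_red:
  assumes "reduced w"
  shows "foldr cons_red (cons_red a v) w = cons_red a (foldr cons_red v w)"
  by (cases v) (auto simp: cons_red_cancel reduced_foldr_cons_red assms)

lemma foldr_cons_red_assoc:
  assumes "reduced w"
  shows "foldr cons_red (foldr cons_red u v) w = foldr cons_red u (foldr cons_red v w)"
  by (induction u) (simp_all add: foldr_cons_red_cons_red assms)

lemma foldr_cons_red_rev_inv:
  assumes "reduced w"
  shows "foldr cons_red (rev (map inv_letter v)) (foldr cons_red v w) = w"
  using assms
proof (induction v)
  case (Cons a v)
  have "cons_red (inv_letter a) (cons_red a (foldr cons_red v w)) = foldr cons_red v w"
    using cons_red_cancel[of "foldr cons_red v w" "inv_letter a"] Cons.prems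
    by (simp add: reduced_foldr_cons_red)
  with Cons show ?case by simp
qed simp

lemma group_free_group: "group (free_group k)"
proof (rule groupI)
  fix v w assume "v \<in> carrier (free_group k)" "w \<in> carrier (free_group k)"
  then show "v \<otimes>\<^bsub>free_group k\<^esub> w \<in> carrier (free_group k)"
    using set_foldr_cons_red[of v w]
    by (auto simp: free_group_def reduced_foldr_cons_red)
next
  fix w assume w: "w \<in> carrier (free_group k)"
  define v where "v = foldr cons_red (rev (map inv_letter w)) []"
  have "set v \<subseteq> inv_letter ` set w"
    using set_foldr_cons_red[of "rev (map inv_letter w)" "[]"] by (simp add: v_def)
  moreover have "reduced v"
    by (simp add: v_def reduced_foldr_cons_red)
  ultimately have "v \<in> carrier (free_group k)"
    using w by (fastforce simp: free_group_def inv_letter_def)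
  moreover have "v \<otimes>\<^bsub>free_group k\<^esub> w = \<one>\<^bsub>free_group k\<^esub>"
    using w foldr_cons_red_assoc[of w "rev (map inv_letter w)" "[]"]
      foldr_cons_red_rev_inv[of "[]" w]
    by (simp add: free_group_def v_def foldr_cons_red_Nil)
  ultimately show "\<exists>v\<in>carrier (free_group k). v \<otimes>\<^bsub>free_group k\<^esub> w = \<one>\<^bsub>free_group k\<^esub>"
    by blast
qed (auto simp: free_group_def foldr_cons_red_assoc)

definition imprimitive :: "nat \<Rightarrow> letter list \<Rightarrow> bool" where
  "imprimitive k w \<longleftrightarrow>
     (\<exists>v \<in> carrier (free_group k). \<exists>e::nat. e \<ge> 2 \<and> w = v [^]\<^bsub>free_group k\<^esub> e)"

definition primitive :: "nat \<Rightarrow> letter list \<Rightarrow> bool" where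
  "primitive k w \<longleftrightarrow> w \<in> carrier (free_group k) \<and> \<not> imprimitive k w"


section \<open>Substituting group elements into a word\<close>

definition word_subst :: "('a, 'b) monoid_scheme \<Rightarrow> (nat \<Rightarrow> 'a) \<Rightarrow> letter list \<Rightarrow> 'a" where
  "word_subst G s w =
     foldr (\<lambda>a x. (if snd a then s (fst a) else inv\<^bsub>G\<^esub> s (fst a)) \<otimes>\<^bsub>G\<^esub> x) w \<one>\<^bsub>G\<^esub>"

text \<open>
  Substitution is the homomorphism given by the universal property of the free group.
\<close>

lemma word_subst_hom:
  assumes G: "group G" and s: "\<And>i. i \<in> {1..k} \<Longrightarrow> s i \<in> carrier G"
  shows "word_subst G s \<in> hom (free_group k) G"
proof -
  interpret group G by (rule G)
  define f where "f = (\<lambda>a::letter. if snd a then s (fst a) else inv\<^bsub>G\<^esub> s (fst a))"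
  have eq: "word_subst G s w = foldr (\<lambda>a x. f a \<otimes>\<^bsub>G\<^esub> x) w \<one>\<^bsub>G\<^esub>" for w
    by (simp add: word_subst_def f_def)
  have f: "f a \<in> carrier G" if "a \<in> {1..k} \<times> UNIV" for a
    using s that by (auto simp: f_def)
  have f_inv: "f (inv_letter a) = inv\<^bsub>G\<^esub> f a" if "a \<in> {1..k} \<times> UNIV" for a
    using s that by (auto simp: f_def inv_letter_def)
  have cl: "word_subst G s w \<in> carrier G" if "set w \<subseteq> {1..k} \<times> UNIV" for w
    using that by (induction w) (auto simp: eq intro!: m_closed f)
  have step: "word_subst G s (cons_red a w) = f a \<otimes>\<^bsub>G\<^esub> word_subst G s w"
    if "a \<in> {1..k} \<times> UNIV" "set w \<subseteq> {1..k} \<times> UNIV" for a w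
  proof (cases w)
    case (Cons b v)
    have "f a \<otimes>\<^bsub>G\<^esub> (f (inv_letter a) \<otimes>\<^bsub>G\<^esub> word_subst G s v) = word_subst G s v"
      using that Cons f[of a] f_inv[of a] cl[of v] by (simp add: m_assoc[symmetric])
    with Cons show ?thesis by (auto simp: eq)
  qed (simp add: eq)
  have "word_subst G s (foldr cons_red v w) = word_subst G s v \<otimes>\<^bsub>G\<^esub> word_subst G s w"
    if "set v \<subseteq> {1..k} \<times> UNIV" "set w \<subseteq> {1..k} \<times> UNIV" for v w
    using that(1)
  proof (induction v)
    case Nil
    then show ?case using cl that(2) by (simp add: eq[of "[]"])
  next
    case (Cons a v)
    have "set (foldr cons_red v w) \<subseteq> {1..k} \<times> UNIV"
      using set_foldr_cons_red[of v w] Cons.prems that(2) by auto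
    then have "word_subst G s (foldr cons_red (a # v) w)
        = f a \<otimes>\<^bsub>G\<^esub> (word_subst G s v \<otimes>\<^bsub>G\<^esub> word_subst G s w)"
      using Cons step by simp
    also have "\<dots> = word_subst G s (a # v) \<otimes>\<^bsub>G\<^esub> word_subst G s w"
      using Cons.prems cl that(2) f[of a] by (simp add: eq[of "a # v"] eq[of v, symmetric] m_assoc)
    finally show ?case .
  qed
  then show ?thesis
    using cl by (auto simp: hom_def free_group_def)
qed

lemma word_subst_generator:
  assumes "group G" "s i \<in> carrier G"
  shows "word_subst G s [(i, True)] = s i"
proof -
  interpret group G by fact
  show ?thesis using assms by (simp add: word_subst_def)
qed


section \<open>Cycle counts of random permutations\<close>

text \<open>
  The cycles of a permutation of \<open>{1..n}\<close> are identified with its orbits, so fixed points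
  are cycles of length 1.
\<close>

definition num_cycles :: "nat \<Rightarrow> nat \<Rightarrow> (nat \<Rightarrow> nat) \<Rightarrow> nat" where
  "num_cycles n L p = card {C. (\<exists>x\<in>{1..n}. C = orbit p x) \<and> card C = L}"

text \<open>The law of \<open>k\<close> independent uniformly random elements of the symmetric group.\<close>

definition random_perms :: "nat \<Rightarrow> nat \<Rightarrow> (nat \<Rightarrow> nat \<Rightarrow> nat) pmf" where
  "random_perms k n = Pi_pmf {1..k} id (\<lambda>_. pmf_of_set (carrier (sym_group n)))"

definition cycle_count :: "letter list \<Rightarrow> nat \<Rightarrow> nat \<Rightarrow> (nat \<Rightarrow> nat \<Rightarrow> nat) \<Rightarrow> nat" where
  "cycle_count w L n \<sigma> = num_cycles n L (word_subst (sym_group n) \<sigma> w)"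

definition cycle_count_law :: "nat \<Rightarrow> letter list \<Rightarrow> nat \<Rightarrow> nat \<Rightarrow> real measure" where
  "cycle_count_law k w L n =
     distr (measure_pmf (random_perms k n)) borel (\<lambda>\<sigma>. real (cycle_count w L n \<sigma>))"


section \<open>The limit law\<close>

definition H_set :: "nat \<Rightarrow> nat \<Rightarrow> nat set" where
  "H_set d L = {h. h > 0 \<and> h dvd d \<and> gcd (d div h) L = 1}"

text \<open>
  The product \<open>Pi_pmf\<close> makes the coordinates \<open>Z h\<close> independent, with \<open>Z h\<close> Poisson
  distributed with parameter \<open>1 / (L h)\<close>.
\<close>

definition limit_law :: "nat \<Rightarrow> nat \<Rightarrow> real measure" where
  "limit_law d L =
     distr (measure_pmf (Pi_pmf (H_set d L) 0 (\<lambda>h. poisson_pmf (1 / (real L * real h))))) borel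
       (\<lambda>Z. real (\<Sum>h\<in>H_set d L. h * Z h))"

end

theory Submission
  imports Defs "HOL-Real_Asymp.Real_Asymp"
begin

text \<open>
  The cycles of \<open>p ^^ d\<close> of length \<open>L\<close> arise from the cycles of \<open>p\<close> of length \<open>L * h\<close> with
  \<open>h \<in> H_set d L\<close>, each of which splits into \<open>h\<close> cycles. So it suffices that, for primitive \<open>u\<close>, the
  numbers of cycles of \<open>u(\<sigma>)\<close> of finitely many given lengths \<open>m\<close> are asymptotically independent
  Poisson variables with parameters \<open>1 / m\<close>; this is shown by the method of factorial moments.

  After conjugation \<open>u\<close> is cyclically reduced. A list of distinct cycles with marked points is
  traced out letter by letter by closed trajectories, which form a graph with \<open>V\<close> vertices and \<open>E\<close>
  edges, and a given graph occurs with probability of order \<open>n powr (- E)\<close>. Every vertex has degree at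
  least 2, hence \<open>V \<le> E\<close>. If \<open>V = E\<close>, two coinciding points of the trajectories move together for
  ever, in the same direction (then \<open>u\<close> is periodic, hence a proper power, unless the trajectories
  coincide) or in opposite directions (then \<open>u\<close> is a rotation of its own inverse, which is impossible).
  So up to \<open>O(1 / n)\<close> only trajectories without coincidences count, and each moment tends to
  \<open>\<Prod>j<r. 1 / M j\<close>. The characteristic function is then obtained from the moments by truncating
  the expansion of a product over all cycles.
\<close>

section \<open>Cyclic words\<close>

text \<open>Integer positions turn \<open>w\<close> into a bi-infinite periodic word, so that shifts
  by possibly negative amounts and reflections can be written down directly.\<close>

definition cyclic_letter :: "letter list \<Rightarrow> int \<Rightarrow> letter" where
  "cyclic_letter w x = w ! nat (x mod int (length w))"

definition cyclically_reduced :: "letter list \<Rightarrow> bool" where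
  "cyclically_reduced w \<longleftrightarrow>
     w = [] \<or> (\<forall>x. cyclic_letter w (x + 1) \<noteq> inv_letter (cyclic_letter w x))"

text \<open>A power in the free monoid, with no cancellation. The empty word is one too, so a word
  that is no proper power is nonempty.\<close>

definition proper_power :: "'a list \<Rightarrow> bool" where
  "proper_power w \<longleftrightarrow> (\<exists>v e. e \<ge> 2 \<and> w = concat (replicate e v))"

lemma inv_letter_inj [simp]: "inv_letter a = inv_letter b \<longleftrightarrow> a = b"
  by (metis inv_letter_inv_letter)

lemma not_proper_power_nonempty: "\<not> proper_power w \<Longrightarrow> w \<noteq> []"
  unfolding proper_power_def by (metis concat_replicate_trivial le_refl)

lemma proper_power_rev: "proper_power (rev w) \<Longrightarrow> proper_power w"
  by (auto simp: proper_power_def rev_swap rev_concat)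

lemma cyclic_letter_mod [simp]: "cyclic_letter w (x mod (int (length w) * m)) = cyclic_letter w x"
  by (simp add: cyclic_letter_def mod_mod_cancel)

lemma cyclic_letter_add_mult [simp]: "cyclic_letter w (x + int (length w) * m) = cyclic_letter w x"
  by (simp add: cyclic_letter_def)

lemma cyclic_letter_in_set: "w \<noteq> [] \<Longrightarrow> cyclic_letter w x \<in> set w"
  by (auto simp: cyclic_letter_def nat_less_iff)

lemma cyclic_letter_rev:
  assumes "w \<noteq> []"
  shows "cyclic_letter (rev w) x = cyclic_letter w (- x - 1)"
proof -
  define l where "l = int (length w)"
  have l: "l > 0" using assms by (simp add: l_def)
  have b: "0 \<le> x mod l" "x mod l < l" using l by auto
  have "(- x - 1) mod l = (l - 1 - x mod l) mod l"
    by (metis (no_types, opaque_lifting) add.commute add_uminus_conv_diff diff_diff_eq mod_add_self1 mod_diff_right_eq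
        minus_add_distrib uminus_add_conv_diff)
  also have "\<dots> = l - 1 - x mod l" using b by (intro mod_pos_pos_trivial) auto
  finally have e: "(- x - 1) mod l = l - 1 - x mod l" .
  have "nat (l - 1 - x mod l) = length w - Suc (nat (x mod l))"
    using b by (simp add: l_def nat_diff_distrib)
  then show ?thesis
    using b assms unfolding cyclic_letter_def length_rev l_def[symmetric] e
    by (subst rev_nth) (auto simp: l_def nat_less_iff)
qed

lemma cyclically_reduced_rev:
  assumes "cyclically_reduced w" "w \<noteq> []"
  shows "cyclically_reduced (rev w)"
  unfolding cyclically_reduced_def
proof (intro disjI2 allI)
  fix x
  have "cyclic_letter w (- x - 2 + 1) \<noteq> inv_letter (cyclic_letter w (- x - 2))"
    using assms unfolding cyclically_reduced_def by blast
  moreover have "cyclic_letter (rev w) (x + 1) = cyclic_letter w (- x - 2)"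
    using cyclic_letter_rev[OF assms(2), of "x + 1"] by (simp add: algebra_simps)
  moreover have "cyclic_letter (rev w) x = cyclic_letter w (- x - 2 + 1)"
    unfolding cyclic_letter_rev[OF assms(2), of x] by (rule arg_cong[where f = "cyclic_letter w"]) simp
  ultimately show "cyclic_letter (rev w) (x + 1) \<noteq> inv_letter (cyclic_letter (rev w) x)"
    by (metis inv_letter_inv_letter)
qed

lemma cyclically_reducedI:
  assumes "reduced w" "w \<noteq> [] \<Longrightarrow> hd w \<noteq> inv_letter (last w)"
  shows "cyclically_reduced w"
proof (cases "w = []")
  case True
  then show ?thesis by (simp add: cyclically_reduced_def)
next
  case False
  show ?thesis unfolding cyclically_reduced_def
  proof (intro disjI2 allI)
    fix x
    define l where "l = int (length w)"
    have l: "l > 0" using False by (simp add: l_def)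
    have b: "0 \<le> x mod l" "x mod l < l" using l by auto
    define t where "t = nat (x mod l)"
    have t: "t < length w" using b by (simp add: t_def l_def nat_less_iff)
    have s: "(x + 1) mod l = (x mod l + 1) mod l" by (simp add: mod_add_left_eq)
    show "cyclic_letter w (x + 1) \<noteq> inv_letter (cyclic_letter w x)"
    \<comment> \<open>At the last position the successor wraps round to the head of
      \<open>w\<close>; this is where the second assumption enters.\<close>
    proof (cases "x mod l + 1 = l")
      case True
      then have "nat ((x + 1) mod l) = 0" "t = length w - 1" using s by (auto simp: t_def l_def)
      then show ?thesis using assms(2) False
        by (simp add: cyclic_letter_def hd_conv_nth last_conv_nth flip: l_def t_def)
    next
      case 2: False
      then have "(x + 1) mod l = x mod l + 1" using b s by (simp add: mod_pos_pos_trivial)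
      then have "nat ((x + 1) mod l) = Suc t" using b by (simp add: t_def)
      moreover have "Suc t < length w" using 2 b t by (auto simp: t_def l_def)
      then have "w ! Suc t \<noteq> inv_letter (w ! t)"
        using assms(1) by (auto simp: reduced_def successively_conv_nth)
      ultimately show ?thesis by (simp add: cyclic_letter_def flip: l_def t_def)
    qed
  qed
qed

lemma concat_replicate_nth:
  "i < e * length v \<Longrightarrow> concat (replicate e v) ! i = v ! (i mod length v)"
proof (induction e arbitrary: i)
  case (Suc e)
  show ?case
  proof (cases "i < length v")
    case False
    then have "i - length v < e * length v" using Suc.prems by auto
    moreover have "(i - length v) mod length v = i mod length v"
      using False by (simp add: le_mod_geq)
    ultimately show ?thesis using Suc.IH[of "i - length v"] False by (simp add: nth_append)
  qed (simp add: nth_append)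
qed simp

text \<open>Both \<open>r\<close> and \<open>length w\<close> are periods, hence so is their gcd
  \<open>g\<close> by Bezout. Then \<open>w\<close> repeats its prefix of length \<open>g\<close>,
  and a word that is no proper power leaves only \<open>g = length w\<close>.\<close>

lemma cyclic_letter_shift:
  assumes "\<not> proper_power w" and shift: "\<And>x. cyclic_letter w (x + r) = cyclic_letter w x"
  shows "int (length w) dvd r"
proof -
  define l where "l = length w"
  define g where "g = nat (gcd r (int l))"
  have ne: "w \<noteq> []" using assms(1) by (rule not_proper_power_nonempty)
  then have l: "l > 0" by (simp add: l_def)
  have g: "g > 0" "int g = gcd r (int l)" using l by (auto simp: g_def)
  have "g dvd l" using g(2) by (metis gcd_dvd2 int_dvd_int_iff)
  then obtain e where e: "l = g * e" by blast
  have mult: "cyclic_letter w (x + r * int m) = cyclic_letter w x" for x m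
  proof (induction m)
    case (Suc m)
    have "cyclic_letter w (x + r * int (Suc m)) = cyclic_letter w ((x + r * int m) + r)"
      by (simp add: algebra_simps)
    then show ?case using Suc by (simp add: shift)
  qed simp
  \<comment> \<open>A negative multiple is undone by a positive one started at the shifted
    point.\<close>
  have mult': "cyclic_letter w (x + r * m) = cyclic_letter w x" for x m
  proof (cases "m \<ge> 0")
    case True
    then show ?thesis using mult[of x "nat m"] by simp
  next
    case False
    then show ?thesis using mult[of "x + r * m" "nat (-m)"] by simp
  qed
  obtain a b where ab: "a * r + b * int l = gcd r (int l)"
    using bezout_int by blast
  have sg: "cyclic_letter w (x + int g) = cyclic_letter w x" for x
  proof -
    have "x + int g = x + r * a + int (length w) * b" using ab g by (simp add: l_def algebra_simps)
    then show ?thesis by (simp only: cyclic_letter_add_mult mult')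
  qed
  have sg': "cyclic_letter w (x + int g * int m) = cyclic_letter w x" for x m
  proof (induction m)
    case (Suc m)
    have "cyclic_letter w (x + int g * int (Suc m)) = cyclic_letter w ((x + int g * int m) + int g)"
      by (simp add: algebra_simps)
    then show ?case using Suc by (simp add: sg)
  qed simp
  have "g \<le> l" using \<open>g dvd l\<close> l by (rule dvd_imp_le)
  have "w = concat (replicate e (take g w))"
  proof (rule nth_equalityI)
    show len: "length w = length (concat (replicate e (take g w)))"
      using e \<open>g \<le> l\<close> by (simp add: length_concat sum_list_replicate l_def)
    fix i assume i: "i < length w"
    have cl: "cyclic_letter w (int j) = w ! j" if "j < length w" for j
      using that by (simp add: cyclic_letter_def flip: zmod_int)
    have "w ! i = cyclic_letter w (int (i mod g) + int g * int (i div g))"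
      using i by (simp flip: of_nat_mult of_nat_add add: cl)
    also have "\<dots> = cyclic_letter w (int (i mod g))" by (rule sg')
    also have "\<dots> = w ! (i mod g)"
      using i by (intro cl) (meson le_less_trans mod_less_eq_dividend)
    also have "\<dots> = concat (replicate e (take g w)) ! i"
      using e \<open>g \<le> l\<close> i g(1) by (subst concat_replicate_nth) (auto simp: l_def mult.commute min_def)
    finally show "w ! i = concat (replicate e (take g w)) ! i" .
  qed
  then have "\<not> e \<ge> 2" using assms(1) unfolding proper_power_def by blast
  moreover have "e \<noteq> 0" using e l by auto
  ultimately have "e = 1" by simp
  then have "int l = gcd r (int l)" using e g by simp
  then show ?thesis unfolding l_def[symmetric] by (metis gcd_dvd1)
qed

text \<open>At the centre of the reflection a letter would equal its inverse or be followed by it.\<close>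

lemma cyclic_letter_no_reflection:
  assumes "cyclically_reduced w" "w \<noteq> []"
  shows "\<exists>x. cyclic_letter w x \<noteq> inv_letter (cyclic_letter w (c - x))"
proof (rule ccontr)
  assume "\<not> ?thesis"
  then have *: "cyclic_letter w x = inv_letter (cyclic_letter w (c - x))" for x by blast
  show False
  proof (cases "even c")
    case True
    then obtain m where "c = 2 * m" by blast
    then show False using *[of m] by simp
  next
    case False
    then obtain m where "c = 2 * m + 1" by (rule oddE)
    then show False using *[of m] assms unfolding cyclically_reduced_def
      by (metis add_diff_cancel_left' diff_diff_add inv_letter_inv_letter mult_2 add.assoc)
  qed
qed

section \<open>Formal inverses and cyclic reduction\<close>

definition inv_word :: "letter list \<Rightarrow> letter list" where
  "inv_word w = rev (map inv_letter w)"

lemma inv_word_inv_word [simp]: "inv_word (inv_word w) = w"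
  by (simp add: inv_word_def rev_map comp_def)

lemma reduced_append_left: "reduced (v @ w) \<Longrightarrow> reduced v"
  and reduced_append_right: "reduced (v @ w) \<Longrightarrow> reduced w"
  by (auto simp: reduced_def successively_append_iff)

text \<open>As long as the first letter is the inverse of the last, both are stripped off and moved
  into the conjugator; the length drops by two each time.\<close>

lemma cyclic_reduction:
  assumes "reduced w"
  obtains c v where "w = c @ v @ inv_word c" "cyclically_reduced v"
  using assms
proof (induction "length w" arbitrary: w thesis rule: less_induct)
  case less
  show ?case
  proof (cases "w \<noteq> [] \<and> hd w = inv_letter (last w)")
    case False
    then have "cyclically_reduced w" using less.prems(2) by (intro cyclically_reducedI) auto
    then show thesis using less.prems(1)[of "[]" w] by (simp add: inv_word_def)
  next
    case True
    define a where "a = hd w"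
    obtain w' where w': "w = a # w'" using True by (cases w) (auto simp: a_def)
    \<comment> \<open>No letter is its own inverse, so a word whose ends cancel has at least two
      letters.\<close>
    have "w' \<noteq> []" using True w' by auto
    then obtain w'' b where w'': "w' = w'' @ [b]" by (metis rev_exhaust)
    then have b: "b = inv_letter a" using True w' w'' by simp
    have "reduced w''"
      using less.prems(2) w' w'' by (metis append_Cons append_Nil reduced_append_left reduced_append_right)
    then obtain c v where "w'' = c @ v @ inv_word c" "cyclically_reduced v"
      using less.hyps[of w''] w' w'' by auto
    then show thesis using less.prems(1)[of "a # c" v] w' w'' b by (simp add: inv_word_def)
  qed
qed

section \<open>Normal forms\<close>

abbreviation normal_form :: "letter list \<Rightarrow> letter list" where
  "normal_form w \<equiv> foldr cons_red w []"

lemma foldr_cons_red_normal_form: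
  "reduced w \<Longrightarrow> foldr cons_red (normal_form v) w = foldr cons_red v w"
  using foldr_cons_red_assoc[of w v "[]"] by simp

lemma normal_form_pow:
  "normal_form w [^]\<^bsub>free_group k\<^esub> (e::nat) = normal_form (concat (replicate e w))"
proof -
  \<comment> \<open>The group power multiplies on the right, whereas
    \<open>replicate (Suc e) w\<close> unfolds on the left.\<close>
  have c: "concat (replicate e w) @ w = w @ concat (replicate e w)" for e
    by (induction e) auto
  have "normal_form w [^]\<^bsub>free_group k\<^esub> e = foldr cons_red (concat (replicate e w)) []"
  proof (induction e)
    case 0
    then show ?case by (simp add: free_group_def)
  next
    case (Suc e)
    have "normal_form w [^]\<^bsub>free_group k\<^esub> Suc e
      = foldr cons_red (normal_form (concat (replicate e w))) (normal_form w)"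
      using Suc by (simp add: nat_pow_def free_group_def)
    also have "\<dots> = foldr cons_red (concat (replicate e w) @ w) []"
      by (simp add: foldr_cons_red_normal_form reduced_foldr_cons_red)
    finally show ?case by (simp add: c)
  qed
  then show ?thesis by simp
qed

text \<open>The inner factors \<open>inv_word c @ c\<close> telescope. The induction runs over the
  action on lists of the form \<open>foldr cons_red c x\<close>, so that the last factor
  \<open>inv_word c\<close> also meets a \<open>c\<close> to cancel.\<close>

lemma normal_form_conj_power:
  "normal_form (concat (replicate e (c @ y @ inv_word c))) = normal_form (c @ concat (replicate e y) @ inv_word c)"
proof -
  have cancel: "foldr cons_red c (foldr cons_red (inv_word c) x) = x" if "reduced x" for c x
    using foldr_cons_red_rev_inv[OF that, of "inv_word c"]
    unfolding inv_word_def[symmetric, of "inv_word c"] by simp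
  have cancel': "foldr cons_red (inv_word c) (foldr cons_red c x) = x" if "reduced x" for c x
    using cancel[OF that, of "inv_word c"] by simp
  have "foldr cons_red (concat (replicate e (c @ y @ inv_word c))) (foldr cons_red c x)
      = foldr cons_red c (foldr cons_red (concat (replicate e y)) x)" if "reduced x" for x
    using that by (induction e) (simp_all add: cancel' reduced_foldr_cons_red)
  \<comment> \<open>For this \<open>x\<close> the list \<open>foldr cons_red c x\<close> is empty,
    so the left side becomes a normal form.\<close>
  from this[of "normal_form (inv_word c)"] show ?thesis
    by (simp add: cancel reduced_foldr_cons_red)
qed

text \<open>If the core \<open>v\<close> were \<open>y\<close> repeated \<open>e \<ge> 2\<close>
  times, then \<open>u\<close> would be the \<open>e\<close>-th power of the conjugate of
  \<open>y\<close> by \<open>c\<close>. So primitivity in the group passes to a statement about the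
  list \<open>v\<close>.\<close>

lemma primitive_cyclic_reduction:
  assumes "primitive k u"
  obtains c v where "u = c @ v @ inv_word c" "cyclically_reduced v" "\<not> proper_power v"
    "set u \<subseteq> {1..k} \<times> UNIV"
proof -
  have u: "reduced u" "set u \<subseteq> {1..k} \<times> UNIV" and np: "\<not> imprimitive k u"
    using assms by (auto simp: primitive_def free_group_def)
  obtain c v where cv: "u = c @ v @ inv_word c" "cyclically_reduced v"
    using cyclic_reduction[OF u(1)] .
  have "\<not> proper_power v"
  proof
    assume "proper_power v"
    then obtain y e where y: "e \<ge> 2" "v = concat (replicate e y)"
      by (auto simp: proper_power_def)
    define z where "z = c @ y @ inv_word c"
    have "u = normal_form u" using foldr_cons_red_Nil[OF u(1)] by simp
    also have "\<dots> = normal_form (concat (replicate e z))"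
      unfolding z_def normal_form_conj_power y(2)[symmetric] cv(1)[symmetric] ..
    also have "\<dots> = normal_form z [^]\<^bsub>free_group k\<^esub> e"
      by (simp add: normal_form_pow)
    finally have "u = normal_form z [^]\<^bsub>free_group k\<^esub> e" .
    moreover have "set z \<subseteq> {1..k} \<times> UNIV"
      using u(2) y unfolding cv(1) z_def by auto
    then have "normal_form z \<in> carrier (free_group k)"
      using set_foldr_cons_red[of z "[]"] by (auto simp: free_group_def reduced_foldr_cons_red)
    ultimately show False using np y(1) by (auto simp: imprimitive_def)
  qed
  then show thesis using that cv u by blast
qed

section \<open>Closed trajectories of a word\<close>

definition letter_act :: "(nat \<Rightarrow> 'a \<Rightarrow> 'a) \<Rightarrow> letter \<Rightarrow> 'a \<Rightarrow> 'a" where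
  "letter_act \<sigma> a = (if snd a then \<sigma> (fst a) else inv' (\<sigma> (fst a)))"

lemma letter_act_inv_letter:
  assumes "bij (\<sigma> (fst a))"
  shows "letter_act \<sigma> (inv_letter a) (letter_act \<sigma> a x) = x"
  using assms by (auto simp: letter_act_def inv_letter_def inv_f_f bij_is_inj surj_f_inv_f bij_is_surj)

text \<open>The data of one factorial moment: \<open>r\<close> marked cycles of prescribed lengths
  \<open>M j\<close>. Going once round the \<open>j\<close>-th cycle reads the word \<open>w\<close>
  exactly \<open>M j\<close> times.\<close>

locale trajectories =
  fixes w :: "letter list" and r :: nat and M :: "nat \<Rightarrow> nat"
  assumes cyclically_reduced: "cyclically_reduced w"
    and not_proper_power: "\<not> proper_power w"
    and period_pos: "\<And>j. j < r \<Longrightarrow> M j > 0"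
begin

definition len :: "nat \<Rightarrow> int" where
  "len j = int (length w * M j)"

definition Pos :: "(nat \<times> int) set" where
  "Pos = (SIGMA j:{..<r}. {0..<len j})"

text \<open>The times at which whole copies of \<open>w\<close> have been read. Injectivity on
  \<open>Base\<close> encodes that the cycles are distinct and that the \<open>j\<close>-th has
  exact length \<open>M j\<close>; points visited in between may still coincide.\<close>

definition Base :: "(nat \<times> int) set" where
  "Base = {(j, x) \<in> Pos. int (length w) dvd x}"

definition succ :: "nat \<times> int \<Rightarrow> nat \<times> int" where
  "succ = (\<lambda>(j, x). (j, (x + 1) mod len j))"

definition lab :: "nat \<times> int \<Rightarrow> letter" where
  "lab p = cyclic_letter w (snd p)"

definition compatible :: "(nat \<Rightarrow> 'a \<Rightarrow> 'a) \<Rightarrow> (nat \<times> int \<Rightarrow> 'a) \<Rightarrow> bool" where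
  "compatible \<sigma> f \<longleftrightarrow> (\<forall>p\<in>Pos. letter_act \<sigma> (lab p) (f p) = f (succ p))"

text \<open>Whatever the sign of its letter, position \<open>p\<close> says that a generator maps \<open>source f p\<close> to \<open>target f p\<close>.\<close>

definition source :: "(nat \<times> int \<Rightarrow> 'a) \<Rightarrow> nat \<times> int \<Rightarrow> 'a" where
  "source f p = (if snd (lab p) then f p else f (succ p))"

definition target :: "(nat \<times> int \<Rightarrow> 'a) \<Rightarrow> nat \<times> int \<Rightarrow> 'a" where
  "target f p = (if snd (lab p) then f (succ p) else f p)"

text \<open>For a compatible \<open>f\<close> an edge is determined by its generator and its source,
  so \<open>card (sources f i)\<close> is the number of edges labelled by generator
  \<open>i\<close>.\<close>

definition sources :: "(nat \<times> int \<Rightarrow> 'a) \<Rightarrow> nat \<Rightarrow> 'a set" where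
  "sources f i = source f ` {p \<in> Pos. fst (lab p) = i}"

lemma word_nonempty: "w \<noteq> []"
  using not_proper_power by (rule not_proper_power_nonempty)

lemma len_pos: "j < r \<Longrightarrow> len j > 0"
  using word_nonempty period_pos[of j] by (simp add: len_def)

lemma finite_Pos [simp, intro]: "finite Pos"
  by (simp add: Pos_def)

lemma finite_sources [simp, intro]: "finite (sources f i)"
  by (simp add: sources_def)

lemma succ_in_Pos: "p \<in> Pos \<Longrightarrow> succ p \<in> Pos"
  using len_pos by (auto simp: Pos_def succ_def)

lemma inj_succ: "inj_on succ Pos"
proof (rule inj_onI, clarsimp simp: Pos_def succ_def)
  fix j x y assume *: "(x + 1) mod len j = (y + 1) mod len j" "0 \<le> x" "x < len j" "0 \<le> y" "y < len j"
  then have "(x + 1 - 1) mod len j = (y + 1 - 1) mod len j" by (metis mod_diff_left_eq)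
  then show "x = y" using * by simp
qed

lemma succ_surj: "succ ` Pos = Pos"
  by (rule card_subset_eq) (auto simp: succ_in_Pos card_image inj_succ)

lemma lab_mod [simp]: "lab (j, x mod len j) = cyclic_letter w x"
  by (simp add: lab_def len_def)

lemma lab_succ: "lab (succ p) = cyclic_letter w (snd p + 1)"
  by (cases p) (simp add: succ_def)

lemma lab_succ_neq: "lab (succ p) \<noteq> inv_letter (lab p)"
  using cyclically_reduced word_nonempty unfolding cyclically_reduced_def lab_succ by (auto simp: lab_def)

lemma lab_in_set: "lab p \<in> set w"
  unfolding lab_def using word_nonempty by (rule cyclic_letter_in_set)

lemma lab_fst: "set w \<subseteq> I \<times> UNIV \<Longrightarrow> fst (lab p) \<in> I"
  using lab_in_set[of p] by auto

lemma card_labels: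
  assumes "finite I" "set w \<subseteq> I \<times> UNIV"
  shows "(\<Sum>i\<in>I. card {p \<in> Pos. fst (lab p) = i}) = card Pos"
  unfolding card_eq_sum using assms lab_fst[OF assms(2)]
  by (intro sum.group) auto

text \<open>
  The trajectories trace out a graph with vertex set \<open>f ` Pos\<close>. A dart is a vertex together
  with the letter of an edge leaving it; reducedness gives every vertex at least two darts.
\<close>

definition darts :: "(nat \<times> int \<Rightarrow> 'a) \<Rightarrow> ('a \<times> letter) set" where
  "darts f = (\<lambda>p. (f p, lab p)) ` Pos \<union> (\<lambda>p. (f (succ p), inv_letter (lab p))) ` Pos"

lemma finite_darts [simp]: "finite (darts f)"
  by (simp add: darts_def)

text \<open>Every edge carries at most two darts: one leaving its source along the generator and one
  leaving its target along the inverse.\<close>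

lemma card_darts_le:
  assumes "compatible \<sigma> f" "finite I" "set w \<subseteq> I \<times> UNIV" "\<And>i. i \<in> I \<Longrightarrow> bij (\<sigma> i)"
  shows "card (darts f) \<le> 2 * (\<Sum>i\<in>I. card (sources f i))"
proof -
  let ?E = "\<lambda>i. sources f i \<times> {(i, True)} \<union> (\<sigma> i ` sources f i) \<times> {(i, False)}"
  have "darts f \<subseteq> (\<Union>i\<in>I. ?E i)"
  proof -
    have "(f p, lab p) \<in> ?E (fst (lab p)) \<and> (f (succ p), inv_letter (lab p)) \<in> ?E (fst (lab p))"
      if p: "p \<in> Pos" for p
    proof -
      have src: "source f p \<in> sources f (fst (lab p))" using p by (auto simp: sources_def)
      have act: "letter_act \<sigma> (lab p) (f p) = f (succ p)"
        using assms(1) p by (simp add: compatible_def)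
      have bij: "bij (\<sigma> (fst (lab p)))" using assms(4) lab_fst[OF assms(3)] by blast
      show ?thesis
      proof (cases "snd (lab p)")
        case True
        then have "lab p = (fst (lab p), True)" by (metis prod.collapse)
        moreover have "inv_letter (lab p) = (fst (lab p), False)" using True by (simp add: inv_letter_def)
        moreover have "\<sigma> (fst (lab p)) (f p) = f (succ p)" using act True by (simp add: letter_act_def)
        ultimately show ?thesis using src True by (auto simp: source_def intro: rev_image_eqI)
      next
        case False
        then have "lab p = (fst (lab p), False)" by (metis prod.collapse)
        moreover have "inv_letter (lab p) = (fst (lab p), True)" using False by (simp add: inv_letter_def)
        moreover have "f p = \<sigma> (fst (lab p)) (f (succ p))"
          using act False bij by (metis letter_act_def bij_inv_eq_iff)
        ultimately show ?thesis using src False by (auto simp: source_def intro: rev_image_eqI)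
      qed
    qed
    note in_E = this
    show ?thesis
    proof
      fix e assume "e \<in> darts f"
      then obtain p where p: "p \<in> Pos" "e = (f p, lab p) \<or> e = (f (succ p), inv_letter (lab p))"
        unfolding darts_def by blast
      then have "e \<in> ?E (fst (lab p))" using in_E[OF p(1)] by metis
      then show "e \<in> (\<Union>i\<in>I. ?E i)" using lab_fst[OF assms(3), of p] by (rule UN_I[rotated])
    qed
  qed
  then have "card (darts f) \<le> card (\<Union>i\<in>I. ?E i)"
    using assms(2) by (intro card_mono) auto
  also have "\<dots> \<le> (\<Sum>i\<in>I. card (?E i))" by (rule card_UN_le[OF assms(2)])
  also have "\<dots> \<le> (\<Sum>i\<in>I. 2 * card (sources f i))"
  proof (rule sum_mono)
    fix i
    have "card (?E i) \<le> card (sources f i \<times> {(i, True)}) + card ((\<sigma> i ` sources f i) \<times> {(i, False)})"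
      by (rule card_Un_le)
    also have "\<dots> \<le> 2 * card (sources f i)"
      using card_image_le[OF finite_sources, of "\<sigma> i" f i] by (simp add: card_cartesian_product)
    finally show "card (?E i) \<le> 2 * card (sources f i)" .
  qed
  finally show ?thesis by (simp add: sum_distrib_left)
qed

text \<open>At \<open>f (succ p)\<close> one dart points back along the edge just used and one
  points forward along the next edge; they differ because a cyclically reduced word never
  backtracks.\<close>

lemma darts_at_vertex:
  assumes "p \<in> Pos"
  shows "{inv_letter (lab p), lab (succ p)} \<subseteq> {a. (f (succ p), a) \<in> darts f}"
    "card {inv_letter (lab p), lab (succ p)} = 2"
  using assms lab_succ_neq[of p] by (auto simp: darts_def succ_in_Pos)

lemma finite_darts_at [simp]: "finite {a. (v, a) \<in> darts f}"
  by (rule finite_subset[of _ "snd ` darts f"]) force+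

lemma two_darts:
  assumes "v \<in> f ` Pos"
  shows "2 \<le> card {a. (v, a) \<in> darts f}"
proof -
  obtain q where q: "q \<in> Pos" "v = f q" using assms by blast
  then have "q \<in> succ ` Pos" by (simp only: succ_surj)
  then obtain p where p: "p \<in> Pos" "q = succ p" by blast
  then show ?thesis
    using card_mono[OF finite_darts_at darts_at_vertex(1)[OF p(1)]] darts_at_vertex(2)[OF p(1)] q by metis
qed

lemma card_darts: "card (darts f) = (\<Sum>v\<in>f ` Pos. card {a. (v, a) \<in> darts f})"
proof -
  have "darts f = (SIGMA v:f ` Pos. {a. (v, a) \<in> darts f})"
    using succ_in_Pos by (auto simp: darts_def)
  then have "card (darts f) = card (SIGMA v:f ` Pos. {a. (v, a) \<in> darts f})" by simp
  then show ?thesis by (subst (asm) card_SigmaI) auto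
qed

text \<open>Darts are counted in two ways: at least two at each vertex, at most two on each
  edge.\<close>

lemma vertices_le_edges:
  assumes "compatible \<sigma> f" "finite I" "set w \<subseteq> I \<times> UNIV" "\<And>i. i \<in> I \<Longrightarrow> bij (\<sigma> i)"
  shows "card (f ` Pos) \<le> (\<Sum>i\<in>I. card (sources f i))"
proof -
  have "(\<Sum>v\<in>f ` Pos. 2) \<le> card (darts f)"
    unfolding card_darts by (intro sum_mono two_darts)
  then show ?thesis using card_darts_le[OF assms] by simp
qed

text \<open>Equality in the double count leaves exactly two darts at each vertex. Every passage
  through a vertex exhibits two distinct ones, so all passages exhibit the same pair.\<close>

lemma darts_rigid:
  assumes "compatible \<sigma> f" "finite I" "set w \<subseteq> I \<times> UNIV" "\<And>i. i \<in> I \<Longrightarrow> bij (\<sigma> i)"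
    and eq: "card (f ` Pos) = (\<Sum>i\<in>I. card (sources f i))"
    and pq: "p \<in> Pos" "q \<in> Pos" "f (succ p) = f (succ q)"
  shows "{inv_letter (lab p), lab (succ p)} = {inv_letter (lab q), lab (succ q)}"
proof -
  have "(\<Sum>v\<in>f ` Pos. 2) \<le> card (darts f)"
    unfolding card_darts by (intro sum_mono two_darts)
  then have "(\<Sum>v\<in>f ` Pos. 2) = (\<Sum>v\<in>f ` Pos. card {a. (v, a) \<in> darts f})"
    using card_darts_le[OF assms(1-4)] eq by (simp flip: card_darts)
  then have two: "card {a. (v, a) \<in> darts f} = 2" if "v \<in> f ` Pos" for v
    using sum_mono_inv[of "\<lambda>_. 2" "f ` Pos" "\<lambda>v. card {a. (v, a) \<in> darts f}" v] that
    by (simp add: two_darts)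
  have "{inv_letter (lab p), lab (succ p)} = {a. (f (succ p), a) \<in> darts f}" if "p \<in> Pos" for p
    using that darts_at_vertex(1)[of p f] darts_at_vertex(2)[of p] two[of "f (succ p)"]
    by (intro card_subset_eq) (auto simp: succ_in_Pos)
  then show ?thesis using pq by metis
qed

text \<open>
  In the case of equality two coinciding points of the trajectories stay together for ever, in the
  same or in opposite directions. Opposite directions would make \<open>w\<close> a rotation of its inverse; with
  equal directions, the offset is a period of \<open>w\<close>, so the coincidence is visible on \<open>Base\<close>.
\<close>

lemma inj_if_vertices_eq_edges:
  assumes compat: "compatible \<sigma> f" and I: "finite I" "set w \<subseteq> I \<times> UNIV"
    and bij: "\<And>i. i \<in> I \<Longrightarrow> bij (\<sigma> i)"
    and eq: "card (f ` Pos) = (\<Sum>i\<in>I. card (sources f i))"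
    and base: "inj_on f Base"
  shows "inj_on f Pos"
proof (rule inj_onI)
  let ?b = "cyclic_letter w"
  \<comment> \<open>\<open>F j\<close> extends the \<open>j\<close>-th trajectory periodically to
    all integer times.\<close>
  define F where "F j x = f (j, x mod len j)" for j x
  have pos: "(j, x mod len j) \<in> Pos" if "j < r" for j x
    using that len_pos[of j] by (auto simp: Pos_def)
  have succ: "succ (j, x mod len j) = (j, (x + 1) mod len j)" for j x
    by (simp add: succ_def mod_add_left_eq)
  have step: "letter_act \<sigma> (?b x) (F j x) = F j (x + 1)" if "j < r" for j x
    using compat pos[OF that, of x] succ[of j x] unfolding compatible_def F_def
    by (metis lab_mod)
  have undo: "letter_act \<sigma> (inv_letter (?b x)) (F j (x + 1)) = F j x" if "j < r" for j x
    using lab_fst[OF I(2), of "(j, x)"] bij unfolding step[OF that, symmetric]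
    by (intro letter_act_inv_letter) (simp add: lab_def)
  have rigid: "{inv_letter (?b x), ?b (x + 1)} = {inv_letter (?b y), ?b (y + 1)}"
    if "j < r" "j' < r" "F j (x + 1) = F j' (y + 1)" for j j' x y
    using darts_rigid[OF compat I bij eq pos[OF that(1), of x] pos[OF that(2), of y]] that(3)
    by (simp add: succ F_def)
  have red: "?b (x + 1) \<noteq> inv_letter (?b x)" for x
    using cyclically_reduced word_nonempty by (auto simp: cyclically_reduced_def)
  fix p q assume "p \<in> Pos" "q \<in> Pos" "f p = f q"
  moreover obtain j x j' y where pq: "p = (j, x)" "q = (j', y)" by fastforce
  ultimately have xy: "(j, x) \<in> Pos" "(j', y) \<in> Pos" "f (j, x) = f (j', y)" by simp_all
  then have j: "j < r" "j' < r" and x: "0 \<le> x" "x < len j" and y: "0 \<le> y" "y < len j'"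
    by (auto simp: Pos_def)
  have Fxy: "F j x = F j' y" using xy x y by (simp add: F_def)
  have w0: "int (length w) > 0" using word_nonempty by simp
  \<comment> \<open>The dart pairs at the common vertex agree as sets: either the outgoing letters
    agree, or the outgoing letter of one passage reverses the incoming letter of the other.\<close>
  consider "?b x = ?b y" | "?b x = inv_letter (?b (y - 1))"
    using rigid[OF j, of "x - 1" "y - 1"] Fxy red[of "y - 1"] red[of "x - 1"]
    by (auto simp: doubleton_eq_iff)
  then show "p = q"
  proof cases
    case 1
    \<comment> \<open>Equal outgoing letters lead to the same next point. The darts pointing back
      agree there, so by rigidity the darts pointing forward agree as well.\<close>
    have same: "F j (x + int s) = F j' (y + int s) \<and> ?b (x + int s) = ?b (y + int s)" for s
    proof (induction s)
      case (Suc s)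
      then have "F j (x + int s + 1) = F j' (y + int s + 1)"
        using step[OF j(1), of "x + int s"] step[OF j(2), of "y + int s"] by simp
      moreover from rigid[OF j this] Suc have "?b (x + int s + 1) = ?b (y + int s + 1)"
        using red[of "x + int s"] red[of "y + int s"] by (auto simp: doubleton_eq_iff)
      ultimately show ?case by (simp add: add_ac)
    qed (use Fxy 1 in simp)
    have "int (length w) dvd x - y"
    proof (rule cyclic_letter_shift[OF not_proper_power])
      fix z
      define s where "s = nat ((z - y) mod int (length w))"
      have s: "int s = (z - y) mod int (length w)" using w0 by (simp add: s_def)
      have "?b (z + (x - y)) = ?b (x + int s)"
        unfolding s cyclic_letter_def by (simp add: mod_add_right_eq algebra_simps)
      also have "\<dots> = ?b (y + int s)" using same by blast
      also have "\<dots> = ?b z"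
        unfolding s cyclic_letter_def by (simp add: mod_add_right_eq algebra_simps)
      finally show "?b (z + (x - y)) = ?b z" .
    qed
    \<comment> \<open>\<open>s\<close> is the time until the first trajectory reaches a multiple of
      \<open>length w\<close>. As \<open>x - y\<close> is divisible by \<open>length w\<close>, the
      second one reaches such a time simultaneously, and injectivity on \<open>Base\<close>
      applies.\<close>
    moreover define s where "s = nat ((- x) mod int (length w))"
    then have "int s = (- x) mod int (length w)" using w0 by simp
    then have dx: "int (length w) dvd x + int s"
      by (simp add: dvd_eq_mod_eq_0 mod_add_right_eq)
    moreover have "y + int s = (x + int s) - (x - y)" by simp
    ultimately have dy: "int (length w) dvd y + int s" by (metis dvd_diff)
    have base_in: "(i, z mod len i) \<in> Base" if "i < r" "int (length w) dvd z" for i z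
      using that pos by (auto simp: Base_def len_def dvd_mod)
    have "(j, (x + int s) mod len j) = (j', (y + int s) mod len j')"
      using same[of s] base base_in[OF j(1) dx] base_in[OF j(2) dy]
      by (auto simp: F_def inj_on_def)
    then have "j = j'" "(x + int s) mod len j = (y + int s) mod len j" by auto
    moreover from this(2) have "(x + int s - int s) mod len j = (y + int s - int s) mod len j"
      by (intro mod_diff_cong refl)
    ultimately have "j = j'" "x mod len j = y mod len j" by simp_all
    then show ?thesis using x y by (simp add: pq)
  next
    case 2
    \<comment> \<open>A step forward on the first trajectory is a step back on the second, and
      rigidity carries the relation between the letters along.\<close>
    have opp: "F j (x + int s) = F j' (y - int s) \<and> ?b (x + int s) = inv_letter (?b (y - int s - 1))" for s
    proof (induction s)
      case (Suc s)
      define X Y where "X = x + int s" and "Y = y - int s - 2"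
      have Y: "y - int s = Y + 1 + 1" "y - int s - 1 = Y + 1" by (simp_all add: Y_def)
      have IH: "F j X = F j' (Y + 1 + 1)" "?b X = inv_letter (?b (Y + 1))"
        using Suc Y by (metis X_def)+
      then have 1: "F j (X + 1) = F j' (Y + 1)"
        using step[OF j(1), of X] undo[OF j(2), of "Y + 1"] by simp
      then have "?b (X + 1) = inv_letter (?b Y)"
        using rigid[OF j 1] IH(2) red[of X] red[of Y]
        by (auto simp: doubleton_eq_iff)
      moreover have "x + int (Suc s) = X + 1" "y - int (Suc s) = Y + 1" "y - int (Suc s) - 1 = Y"
        by (simp_all add: X_def Y_def)
      ultimately show ?case using 1 by metis
    qed (use Fxy 2 in simp)
    \<comment> \<open>Since \<open>s\<close> ranges over all residues modulo
      \<open>length w\<close>, the word read forwards is its inverse read backwards, a reflection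
      with \<open>c = x + y - 1\<close>.\<close>
    have "?b z = inv_letter (?b ((x + y - 1) - z))" for z
    proof -
      define s where "s = nat ((z - x) mod int (length w))"
      have s: "int s = (z - x) mod int (length w)" using w0 by (simp add: s_def)
      have "?b z = ?b (x + int s)"
        unfolding s cyclic_letter_def by (simp add: mod_add_right_eq algebra_simps)
      also have "\<dots> = inv_letter (?b (y - int s - 1))" using opp by blast
      also have "?b (y - int s - 1) = ?b ((y - 1) - int s)" by (simp add: algebra_simps)
      also have "\<dots> = ?b ((x + y - 1) - z)"
      proof -
        have "(y - 1 - (z - x)) mod int (length w) = (x + y - 1 - z) mod int (length w)"
          by (rule arg_cong[where f = "\<lambda>t. t mod _"]) simp
        then show ?thesis unfolding s cyclic_letter_def by (simp only: mod_diff_right_eq)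
      qed
      finally show ?thesis .
    qed
    then show ?thesis
      using cyclic_letter_no_reflection[OF cyclically_reduced word_nonempty, of "x + y - 1"] by blast
  qed
qed

end

section \<open>Counting tuples of permutations\<close>

text \<open>The support of \<open>random_perms\<close>. The default \<open>id\<close> outside
  \<open>{1..k}\<close> makes \<open>\<sigma> i\<close> a permutation for every index
  \<open>i\<close>.\<close>

definition perm_tuples :: "nat \<Rightarrow> nat \<Rightarrow> (nat \<Rightarrow> nat \<Rightarrow> nat) set" where
  "perm_tuples k n = PiE_dflt {1..k} id (\<lambda>_. carrier (sym_group n))"

lemma finite_carrier_sym_group [simp]: "finite (carrier (sym_group n))"
  by (simp add: sym_group_def finite_permutations)

lemma card_carrier_sym_group: "card (carrier (sym_group n)) = fact n"
  using card_permutations[of "{1..n}" n] by (simp add: sym_group_def)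

lemma carrier_sym_group_nonempty [simp]: "carrier (sym_group n) \<noteq> {}"
  by (auto simp: sym_group_def intro: permutes_id)

lemma finite_perm_tuples [simp]: "finite (perm_tuples k n)"
  by (simp add: perm_tuples_def finite_PiE_dflt)

lemma perm_tuples_nonempty [simp]: "perm_tuples k n \<noteq> {}"
  by (simp add: perm_tuples_def)

lemma card_perm_tuples: "card (perm_tuples k n) = fact n ^ k"
  by (simp add: perm_tuples_def card_PiE_dflt card_carrier_sym_group)

lemma random_perms_eq: "random_perms k n = pmf_of_set (perm_tuples k n)"
  unfolding random_perms_def perm_tuples_def by (intro Pi_pmf_of_set) auto

lemma perm_tuples_permutes: "\<sigma> \<in> perm_tuples k n \<Longrightarrow> \<sigma> i permutes {1..n}"
  by (cases "i \<in> {1..k}") (auto simp: perm_tuples_def PiE_dflt_def sym_group_def permutes_id)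

lemma perm_tuples_bij: "\<sigma> \<in> perm_tuples k n \<Longrightarrow> bij (\<sigma> i)"
  using perm_tuples_permutes permutes_bij by blast

text \<open>Composition with \<open>p0\<close> is a bijection from the permutations fixing
  \<open>A\<close> pointwise, that is, the permutations of \<open>S - A\<close>.\<close>

lemma card_permutations_agree:
  assumes "finite S" "p0 permutes S" "A \<subseteq> S"
  shows "card {p. p permutes S \<and> (\<forall>x\<in>A. p x = p0 x)} = fact (card S - card A)"
proof -
  have "bij_betw (\<lambda>q. p0 \<circ> q) {q. q permutes (S - A)} {p. p permutes S \<and> (\<forall>x\<in>A. p x = p0 x)}"
  proof (rule bij_betw_byWitness[where f' = "\<lambda>p. inv' p0 \<circ> p"])
    show "\<forall>q\<in>{q. q permutes (S - A)}. inv' p0 \<circ> (p0 \<circ> q) = q"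
      using permutes_inv_o(2)[OF assms(2)] by (simp flip: comp_assoc)
    show "\<forall>p\<in>{p. p permutes S \<and> (\<forall>x\<in>A. p x = p0 x)}. p0 \<circ> (inv' p0 \<circ> p) = p"
      using permutes_inv_o(1)[OF assms(2)] by (simp flip: comp_assoc)
    show "(\<lambda>q. p0 \<circ> q) ` {q. q permutes (S - A)} \<subseteq> {p. p permutes S \<and> (\<forall>x\<in>A. p x = p0 x)}"
    proof clarify
      fix q assume q: "q permutes S - A"
      then have "q permutes S" by (rule permutes_subset) simp
      moreover have "q x = x" if "x \<in> A" for x
        using permutes_not_in[OF q, of x] that by simp
      ultimately show "p0 \<circ> q permutes S \<and> (\<forall>x\<in>A. (p0 \<circ> q) x = p0 x)"
        using assms(2) by (simp add: permutes_compose)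
    qed
    show "(\<lambda>p. inv' p0 \<circ> p) ` {p. p permutes S \<and> (\<forall>x\<in>A. p x = p0 x)} \<subseteq> {q. q permutes (S - A)}"
    proof clarify
      fix p assume p: "p permutes S" "\<forall>x\<in>A. p x = p0 x"
      have "inv' p0 \<circ> p permutes S" using p(1) assms(2) by (intro permutes_compose permutes_inv)
      moreover have "(inv' p0 \<circ> p) x = x" if "x \<in> S - (S - A)" for x
        using that p(2) permutes_inverses(2)[OF assms(2)] by auto
      ultimately show "inv' p0 \<circ> p permutes S - A" by (rule permutes_superset)
    qed
  qed
  then have "card {p. p permutes S \<and> (\<forall>x\<in>A. p x = p0 x)} = card {q. q permutes (S - A)}"
    by (simp add: bij_betw_same_card)
  also have "\<dots> = fact (card (S - A))"
    using assms by (intro card_permutations) auto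
  finally show ?thesis using assms by (simp add: card_Diff_subset finite_subset)
qed

text \<open>The complements of the two images have equal size, so the partial injection
  \<open>s q\<close> to \<open>t q\<close> is completed by any bijection between them.\<close>

lemma extend_to_permutation:
  assumes "finite S" "inj_on s Q" "inj_on t Q" "s ` Q \<subseteq> S" "t ` Q \<subseteq> S"
  obtains p where "p permutes S" "\<And>q. q \<in> Q \<Longrightarrow> p (s q) = t q"
proof -
  have "card (s ` Q) = card (t ` Q)" using assms by (simp add: card_image)
  then have "card (S - s ` Q) = card (S - t ` Q)"
    using assms by (simp add: card_Diff_subset finite_subset)
  then obtain h where h: "bij_betw h (S - s ` Q) (S - t ` Q)"
    using assms(1) by (metis finite_Diff finite_same_card_bij)
  define g where "g x = (if x \<in> s ` Q then t (inv_into Q s x) else if x \<in> S then h x else x)" for x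
  have "bij_betw (t \<circ> inv_into Q s) (s ` Q) (t ` Q)"
    using assms by (intro bij_betw_trans[OF bij_betw_inv_into]) (auto simp: bij_betw_def)
  then have "bij_betw g (s ` Q) (t ` Q)"
    by (subst bij_betw_cong[where g = "t \<circ> inv_into Q s"]) (auto simp: g_def)
  moreover have "bij_betw g (S - s ` Q) (S - t ` Q)"
    using h by (subst bij_betw_cong[where g = h]) (auto simp: g_def)
  ultimately have "bij_betw g (s ` Q \<union> (S - s ` Q)) (t ` Q \<union> (S - t ` Q))"
    by (rule bij_betw_combine) auto
  then have "bij_betw g S S" using assms by (simp add: Un_absorb1)
  then have "g permutes S" by (rule bij_imp_permutes) (use assms in \<open>auto simp: g_def\<close>)
  moreover have "g (s q) = t q" if "q \<in> Q" for q using that assms(2) by (simp add: g_def)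
  ultimately show thesis by (rule that)
qed

text \<open>The probability that a uniform permutation of \<open>{1..n}\<close> takes prescribed values at \<open>e\<close> points.\<close>

definition agree_prob :: "nat \<Rightarrow> nat \<Rightarrow> real" where
  "agree_prob n e = fact (n - e) / fact n"

lemma agree_prob_pos: "agree_prob n e > 0"
  by (simp add: agree_prob_def)

text \<open>For \<open>e \<le> n\<close> this probability is the reciprocal of a falling factorial;
  passing from \<open>e\<close> to \<open>Suc e\<close> multiplies the expression by
  \<open>n / (n - e)\<close>, which tends to 1.\<close>

lemma agree_prob_asymp: "(\<lambda>n. agree_prob n e * real n ^ e) \<longlonglongrightarrow> 1"
proof (induction e)
  case (Suc e)
  have "(\<lambda>n. agree_prob n e * real n ^ e * (real n / (real n - real e))) \<longlonglongrightarrow> 1 * 1"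
    by (intro tendsto_mult Suc) real_asymp
  moreover have "eventually (\<lambda>n. agree_prob n e * real n ^ e * (real n / (real n - real e))
      = agree_prob n (Suc e) * real n ^ Suc e) sequentially"
    using eventually_gt_at_top[of e]
  proof eventually_elim
    case (elim n)
    then have "n - e = Suc (n - Suc e)" by simp
    then have eq: "fact (n - e) = (real n - real e) * fact (n - Suc e)"
      using elim by (simp add: of_nat_diff)
    show ?case using elim unfolding agree_prob_def eq by simp
  qed
  ultimately show ?case by (simp add: tendsto_cong)
qed (simp add: agree_prob_def)

lemma card_inj_funcset:
  assumes "finite Q" "card Q \<le> n"
  shows "real (card {f \<in> Q \<rightarrow>\<^sub>E {1..n}. inj_on f Q}) = 1 / agree_prob n (card Q)"
proof -
  have "card {f \<in> Q \<rightarrow>\<^sub>E {1..n}. inj_on f Q} = prod ((-) n) {0..<card Q}"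
    using card_inj_on_subset_funcset[of Q "{1..n}" Q] assms by simp
  also have "\<dots> = fact n div fact (n - card Q)"
    by (subst fact_div_fact) (use assms(2) in \<open>auto intro!: prod.reindex_bij_witness[of _ "\<lambda>i. n - i" "\<lambda>i. n - i"]\<close>)
  finally show ?thesis
    using fact_dvd[of "n - card Q" n, where 'a = nat] by (simp add: agree_prob_def real_of_nat_div)
qed

text \<open>A map with \<open>v\<close> values factors through an enumeration \<open>g\<close> of
  its image and a pattern \<open>h\<close> telling which value is taken where.\<close>

lemma card_funcset_image_le:
  assumes "finite Q" "finite S"
  shows "card {f \<in> Q \<rightarrow>\<^sub>E S. card (f ` Q) = v} \<le> card S ^ v * v ^ card Q"
proof -
  let ?G = "({..<v} \<rightarrow>\<^sub>E S) \<times> (Q \<rightarrow>\<^sub>E {..<v})"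
  have "{f \<in> Q \<rightarrow>\<^sub>E S. card (f ` Q) = v} \<subseteq> (\<lambda>(g, h). restrict (g \<circ> h) Q) ` ?G"
  proof clarify
    fix f assume f: "f \<in> Q \<rightarrow>\<^sub>E S" "v = card (f ` Q)"
    then obtain g where g: "bij_betw g {..<v} (f ` Q)"
      using assms by (metis ex_bij_betw_nat_finite finite_imageI lessThan_atLeast0)
    define g' where "g' = restrict g {..<v}"
    define h where "h = restrict (inv_into {..<v} g \<circ> f) Q"
    have hin: "inv_into {..<v} g (f q) \<in> {..<v}" if "q \<in> Q" for q
      using that g by (intro inv_into_into) (auto simp: bij_betw_def)
    have "f q = (restrict (g' \<circ> h) Q) q" for q
    proof (cases "q \<in> Q")
      case True
      then have "g (inv_into {..<v} g (f q)) = f q"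
        using g by (intro f_inv_into_f) (auto simp: bij_betw_def)
      then show ?thesis using True hin[OF True] by (simp add: h_def g'_def)
    next
      case False
      then show ?thesis using f by auto
    qed
    moreover have "g ` {..<v} \<subseteq> S" using g f by (auto simp: bij_betw_def)
    then have "g' \<in> {..<v} \<rightarrow>\<^sub>E S" by (auto simp: g'_def)
    moreover have "h \<in> Q \<rightarrow>\<^sub>E {..<v}" using hin by (auto simp: h_def)
    ultimately show "f \<in> (\<lambda>(g, h). restrict (g \<circ> h) Q) ` (({..<card (f ` Q)} \<rightarrow>\<^sub>E S) \<times> (Q \<rightarrow>\<^sub>E {..<card (f ` Q)}))"
      unfolding f(2)[symmetric] by (intro image_eqI[where x = "(g', h)"]) auto
  qed
  moreover have fin: "finite ?G" using assms by (intro finite_cartesian_product finite_PiE) auto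
  ultimately have "card {f \<in> Q \<rightarrow>\<^sub>E S. card (f ` Q) = v} \<le> card ?G"
    by (rule surj_card_le[rotated])
  also have "\<dots> = card S ^ v * v ^ card Q"
    using assms by (simp add: card_cartesian_product card_funcsetE)
  finally show ?thesis .
qed

section \<open>The probability that given trajectories occur\<close>

context trajectories
begin

lemma compatible_iff:
  assumes "set w \<subseteq> I \<times> UNIV" "\<And>i. i \<in> I \<Longrightarrow> bij (\<sigma> i)"
  shows "compatible \<sigma> f \<longleftrightarrow> (\<forall>p\<in>Pos. \<sigma> (fst (lab p)) (source f p) = target f p)"
proof -
  have "letter_act \<sigma> (lab p) (f p) = f (succ p) \<longleftrightarrow> \<sigma> (fst (lab p)) (source f p) = target f p" for p
    using assms(2)[OF lab_fst[OF assms(1), of p]]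
      bij_inv_eq_iff[of "\<sigma> (fst (lab p))" "f (succ p)" "f p"]
    by (auto simp: letter_act_def source_def target_def)
  then show ?thesis by (simp add: compatible_def)
qed

lemma source_in: "f ` Pos \<subseteq> S \<Longrightarrow> p \<in> Pos \<Longrightarrow> source f p \<in> S"
  and target_in: "f ` Pos \<subseteq> S \<Longrightarrow> p \<in> Pos \<Longrightarrow> target f p \<in> S"
  using succ_in_Pos[of p] by (auto simp: source_def target_def)

text \<open>Once some \<open>\<sigma>0\<close> realises \<open>f\<close>, the tuples that realise it
  are those agreeing with \<open>\<sigma>0\<close> at all sources, which is a separate condition on
  each generator.\<close>

lemma card_compatible:
  assumes w: "set w \<subseteq> {1..k} \<times> UNIV" and f: "f ` Pos \<subseteq> {1..n}"
    and \<sigma>0: "\<sigma>0 \<in> perm_tuples k n" "compatible \<sigma>0 f"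
  shows "card {\<sigma> \<in> perm_tuples k n. compatible \<sigma> f} = (\<Prod>i=1..k. fact (n - card (sources f i)))"
proof -
  have iff: "compatible \<sigma> f \<longleftrightarrow> (\<forall>p\<in>Pos. \<sigma> (fst (lab p)) (source f p) = target f p)"
    if "\<sigma> \<in> perm_tuples k n" for \<sigma>
    using that by (intro compatible_iff[OF w]) (auto intro: perm_tuples_bij)
  have t0: "\<sigma>0 (fst (lab p)) (source f p) = target f p" if "p \<in> Pos" for p
    using \<sigma>0 iff that by blast
  have iff': "compatible \<sigma> f \<longleftrightarrow> (\<forall>i\<in>{1..k}. \<forall>x\<in>sources f i. \<sigma> i x = \<sigma>0 i x)"
    if "\<sigma> \<in> perm_tuples k n" for \<sigma>
    using iff[OF that] t0 lab_fst[OF w] by (auto simp: sources_def)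
  have "{\<sigma> \<in> perm_tuples k n. compatible \<sigma> f} =
      PiE_dflt {1..k} id (\<lambda>i. {p. p permutes {1..n} \<and> (\<forall>x\<in>sources f i. p x = \<sigma>0 i x)})"
  proof -
    have "\<sigma> \<in> perm_tuples k n \<and> compatible \<sigma> f \<longleftrightarrow>
      \<sigma> \<in> PiE_dflt {1..k} id (\<lambda>i. {p. p permutes {1..n} \<and> (\<forall>x\<in>sources f i. p x = \<sigma>0 i x)})" for \<sigma>
      using iff'[of \<sigma>] by (auto simp: perm_tuples_def PiE_dflt_def sym_group_def)
    then show ?thesis by blast
  qed
  also have "card \<dots> = (\<Prod>i=1..k. fact (n - card (sources f i)))"
  proof (subst card_PiE_dflt, simp, simp add: finite_permutations, rule prod.cong[OF refl])
    fix i
    have "sources f i \<subseteq> {1..n}" using source_in[OF f] by (auto simp: sources_def)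
    then show "card {p. p permutes {1..n} \<and> (\<forall>x\<in>sources f i. p x = \<sigma>0 i x)} = fact (n - card (sources f i))"
      using card_permutations_agree[of "{1..n}" "\<sigma>0 i" "sources f i"] perm_tuples_permutes[OF \<sigma>0(1)]
      by simp
  qed
  finally show ?thesis .
qed

lemma compatible_prob:
  assumes w: "set w \<subseteq> {1..k} \<times> UNIV" and f: "f ` Pos \<subseteq> {1..n}"
    and \<sigma>0: "\<sigma>0 \<in> perm_tuples k n" "compatible \<sigma>0 f"
  shows "real (card {\<sigma> \<in> perm_tuples k n. compatible \<sigma> f}) / real (card (perm_tuples k n))
    = (\<Prod>i=1..k. agree_prob n (card (sources f i)))"
  unfolding card_compatible[OF assms] by (simp add: agree_prob_def card_perm_tuples prod_dividef)

text \<open>Two positions with the same generator and the same source either have letters of the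
  same sign and coincide by injectivity of \<open>f\<close>, or are consecutive with mutually
  inverse letters, against reducedness. The same holds for targets.\<close>

lemma inj_source_target:
  assumes "inj_on f Pos"
  shows "inj_on (source f) {p \<in> Pos. fst (lab p) = i}" "inj_on (target f) {p \<in> Pos. fst (lab p) = i}"
proof -
  have no: False if "fst (lab p) = i" "fst (lab (succ p)) = i" "snd (lab (succ p)) \<noteq> snd (lab p)" for p
    using lab_succ_neq[of p] that by (auto simp: inv_letter_def prod_eq_iff)
  have f: "p = q" if "f p = f q" "p \<in> Pos" "q \<in> Pos" for p q
    using that assms by (auto simp: inj_on_def)
  have s: "p = q" if "succ p = succ q" "p \<in> Pos" "q \<in> Pos" for p q
    using that inj_succ by (auto simp: inj_on_def)
  show "inj_on (source f) {p \<in> Pos. fst (lab p) = i}"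
  proof (rule inj_onI)
    fix p q assume "p \<in> {p \<in> Pos. fst (lab p) = i}" "q \<in> {p \<in> Pos. fst (lab p) = i}"
      and eq: "source f p = source f q"
    then have p: "p \<in> Pos" and q: "q \<in> Pos" and i: "fst (lab p) = i" "fst (lab q) = i" by auto
    note sp = succ_in_Pos[OF p] and sq = succ_in_Pos[OF q]
    show "p = q"
    proof (cases "snd (lab p) = snd (lab q)")
      case True
      then have "f p = f q \<or> f (succ p) = f (succ q)" using eq by (auto simp: source_def split: if_splits)
      then show ?thesis using f[OF _ p q] f[OF _ sp sq] s[OF _ p q] by blast
    next
      case False
      then have "f p = f (succ q) \<or> f (succ p) = f q" using eq by (auto simp: source_def split: if_splits)
      then have "p = succ q \<or> succ p = q" using f[OF _ p sq] f[OF _ sp q] by blast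
      then show ?thesis using no[of q] no[of p] False i by auto
    qed
  qed
  show "inj_on (target f) {p \<in> Pos. fst (lab p) = i}"
  proof (rule inj_onI)
    fix p q assume "p \<in> {p \<in> Pos. fst (lab p) = i}" "q \<in> {p \<in> Pos. fst (lab p) = i}"
      and eq: "target f p = target f q"
    then have p: "p \<in> Pos" and q: "q \<in> Pos" and i: "fst (lab p) = i" "fst (lab q) = i" by auto
    note sp = succ_in_Pos[OF p] and sq = succ_in_Pos[OF q]
    show "p = q"
    proof (cases "snd (lab p) = snd (lab q)")
      case True
      then have "f p = f q \<or> f (succ p) = f (succ q)" using eq by (auto simp: target_def split: if_splits)
      then show ?thesis using f[OF _ p q] f[OF _ sp sq] s[OF _ p q] by blast
    next
      case False
      then have "f p = f (succ q) \<or> f (succ p) = f q" using eq by (auto simp: target_def split: if_splits)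
      then have "p = succ q \<or> succ p = q" using f[OF _ p sq] f[OF _ sp q] by blast
      then show ?thesis using no[of q] no[of p] False i by auto
    qed
  qed
qed

text \<open>The values required of each generator form a partial injection of \<open>{1..n}\<close>,
  which extends to a permutation.\<close>

lemma compatible_exists:
  assumes w: "set w \<subseteq> {1..k} \<times> UNIV" and f: "f ` Pos \<subseteq> {1..n}" "inj_on f Pos"
  obtains \<sigma> where "\<sigma> \<in> perm_tuples k n" "compatible \<sigma> f"
proof -
  have "\<exists>p. p permutes {1..n} \<and> (\<forall>q\<in>{p \<in> Pos. fst (lab p) = i}. p (source f q) = target f q)" for i
  proof (rule extend_to_permutation[of "{1..n}" "source f" "{p \<in> Pos. fst (lab p) = i}" "target f"])
    show "inj_on (source f) {p \<in> Pos. fst (lab p) = i}" "inj_on (target f) {p \<in> Pos. fst (lab p) = i}"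
      using f(2) by (rule inj_source_target)+
  qed (use source_in[OF f(1)] target_in[OF f(1)] in auto)
  then have "\<exists>p. \<forall>i. p i permutes {1..n} \<and> (\<forall>q\<in>{p \<in> Pos. fst (lab p) = i}. p i (source f q) = target f q)"
    by (intro choice allI)
  then obtain p where p: "\<forall>i. p i permutes {1..n} \<and> (\<forall>q\<in>{p \<in> Pos. fst (lab p) = i}. p i (source f q) = target f q)"
    by (elim exE)
  define \<sigma> where "\<sigma> i = (if i \<in> {1..k} then p i else id)" for i
  have "p i \<in> carrier (sym_group n)" for i
    using p by (simp add: sym_group_def)
  then have "\<sigma> \<in> perm_tuples k n"
    by (simp add: \<sigma>_def perm_tuples_def PiE_dflt_def)
  moreover have "\<sigma> (fst (lab q)) (source f q) = target f q" if "q \<in> Pos" for q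
    using that p[THEN spec, THEN conjunct2, rule_format, of q "fst (lab q)"] lab_fst[OF w, of q]
    by (simp add: \<sigma>_def)
  then have "compatible \<sigma> f"
    using perm_tuples_bij[OF calculation] by (simp add: compatible_iff[OF w])
  ultimately show thesis by (rule that)
qed

end

lemma sum_of_bool_eq_card: "finite A \<Longrightarrow> (\<Sum>x\<in>A. of_bool (P x)) = card {x \<in> A. P x}"
  by (simp add: of_bool_def sum.If_cases Int_def)

section \<open>The expected number of closed trajectories\<close>

context trajectories
begin

definition closed_trajectories :: "nat \<Rightarrow> (nat \<Rightarrow> nat \<Rightarrow> nat) \<Rightarrow> (nat \<times> int \<Rightarrow> nat) set" where
  "closed_trajectories n \<sigma> = {f \<in> Pos \<rightarrow>\<^sub>E {1..n}. inj_on f Base \<and> compatible \<sigma> f}"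

definition prob :: "nat \<Rightarrow> nat \<Rightarrow> (nat \<times> int \<Rightarrow> nat) \<Rightarrow> real" where
  "prob k n f = real (card {\<sigma> \<in> perm_tuples k n. compatible \<sigma> f}) / real (card (perm_tuples k n))"

lemma finite_Pos_funcset [simp]: "finite S \<Longrightarrow> finite (Pos \<rightarrow>\<^sub>E S)"
  by (intro finite_PiE) auto

text \<open>Linearity of expectation, by exchanging the sums over \<open>\<sigma>\<close> and
  \<open>f\<close>.\<close>

lemma expected_closed_trajectories:
  "(\<Sum>\<sigma>\<in>perm_tuples k n. real (card (closed_trajectories n \<sigma>))) / real (card (perm_tuples k n))
    = (\<Sum>f\<in>{f \<in> Pos \<rightarrow>\<^sub>E {1..n}. inj_on f Base}. prob k n f)"
proof -
  let ?F = "{f \<in> Pos \<rightarrow>\<^sub>E {1..n}. inj_on f Base}"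
  have fin: "finite ?F" by simp
  have "card (closed_trajectories n \<sigma>) = (\<Sum>f\<in>?F. of_bool (compatible \<sigma> f))" for \<sigma>
  proof -
    have "closed_trajectories n \<sigma> = {f \<in> ?F. compatible \<sigma> f}"
      by (auto simp: closed_trajectories_def)
    then show ?thesis by (simp only: sum_of_bool_eq_card[OF fin])
  qed
  then have "(\<Sum>\<sigma>\<in>perm_tuples k n. card (closed_trajectories n \<sigma>)) =
      (\<Sum>\<sigma>\<in>perm_tuples k n. \<Sum>f\<in>?F. of_bool (compatible \<sigma> f))" by simp
  also have "\<dots> = (\<Sum>f\<in>?F. \<Sum>\<sigma>\<in>perm_tuples k n. of_bool (compatible \<sigma> f))"
    by (rule sum.swap)
  also have "\<dots> = (\<Sum>f\<in>?F. card {\<sigma> \<in> perm_tuples k n. compatible \<sigma> f})"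
    by (simp only: sum_of_bool_eq_card[OF finite_perm_tuples])
  finally have "(\<Sum>\<sigma>\<in>perm_tuples k n. real (card (closed_trajectories n \<sigma>))) =
      (\<Sum>f\<in>?F. real (card {\<sigma> \<in> perm_tuples k n. compatible \<sigma> f}))"
    by (simp flip: of_nat_sum)
  then show ?thesis by (simp add: prob_def sum_divide_distrib)
qed

lemma card_sources_inj:
  "inj_on f Pos \<Longrightarrow> card (sources f i) = card {p \<in> Pos. fst (lab p) = i}"
  unfolding sources_def by (intro card_image inj_source_target)

lemma card_sources_le: "card (sources f i) \<le> card Pos"
  unfolding sources_def by (rule order.trans[OF card_image_le card_mono]) auto

text \<open>Without coincidences there are as many edges as positions, \<open>N\<close> in all.
  About \<open>n ^ N\<close> maps each occur with probability about \<open>1 / n ^ N\<close>, and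
  the product of the two counts tends to 1.\<close>

lemma injective_part:
  assumes w: "set w \<subseteq> {1..k} \<times> UNIV"
  shows "(\<lambda>n. \<Sum>f\<in>{f \<in> Pos \<rightarrow>\<^sub>E {1..n}. inj_on f Pos}. prob k n f) \<longlonglongrightarrow> 1"
proof -
  define m where "m i = card {p \<in> Pos. fst (lab p) = i}" for i
  define N where "N = card Pos"
  have mN: "(\<Sum>i=1..k. m i) = N"
    unfolding m_def N_def using w by (intro card_labels) auto
  have "(\<lambda>n. (\<Prod>i=1..k. agree_prob n (m i) * real n ^ m i) / (agree_prob n N * real n ^ N)) \<longlonglongrightarrow> (\<Prod>i=1..k. 1) / 1"
    by (intro tendsto_divide tendsto_prod agree_prob_asymp) auto
  moreover have "eventually (\<lambda>n. (\<Prod>i=1..k. agree_prob n (m i) * real n ^ m i) / (agree_prob n N * real n ^ N) =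
      (\<Sum>f\<in>{f \<in> Pos \<rightarrow>\<^sub>E {1..n}. inj_on f Pos}. prob k n f)) sequentially"
    using eventually_ge_at_top[of "max 1 N"]
  proof eventually_elim
    case (elim n)
    have "prob k n f = (\<Prod>i=1..k. agree_prob n (m i))" if f: "f \<in> Pos \<rightarrow>\<^sub>E {1..n}" "inj_on f Pos" for f
    proof -
      have "f ` Pos \<subseteq> {1..n}" using f by auto
      then obtain \<sigma>0 where "\<sigma>0 \<in> perm_tuples k n" "compatible \<sigma>0 f"
        using compatible_exists[OF w _ f(2)] by blast
      then show ?thesis
        unfolding prob_def using compatible_prob[OF w \<open>f ` Pos \<subseteq> {1..n}\<close>] card_sources_inj[OF f(2)]
        by (simp add: m_def)
    qed
    then have "(\<Sum>f\<in>{f \<in> Pos \<rightarrow>\<^sub>E {1..n}. inj_on f Pos}. prob k n f) =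
        real (card {f \<in> Pos \<rightarrow>\<^sub>E {1..n}. inj_on f Pos}) * (\<Prod>i=1..k. agree_prob n (m i))"
      by simp
    also have "real (card {f \<in> Pos \<rightarrow>\<^sub>E {1..n}. inj_on f Pos}) = 1 / agree_prob n N"
      using elim unfolding N_def by (intro card_inj_funcset) auto
    finally show ?case
      unfolding prod.distrib power_sum[symmetric] mN using elim by simp
  qed
  ultimately show ?thesis by (simp add: tendsto_cong)
qed

text \<open>A realisable map with a coincidence has more edges than vertices, since equality would
  force injectivity on \<open>Pos\<close>. The extra edge gains the factor \<open>1 / n\<close>, and
  each of the \<open>k\<close> generators costs at most a factor 2.\<close>

lemma compatible_prob_le:
  assumes w: "set w \<subseteq> {1..k} \<times> UNIV" and n: "n > 0"
    and small: "\<And>e. e \<le> card Pos \<Longrightarrow> agree_prob n e * real n ^ e \<le> 2"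
    and f: "f ` Pos \<subseteq> {1..n}" "inj_on f Base" "\<not> inj_on f Pos"
  shows "prob k n f * real n ^ card (f ` Pos) \<le> 2 ^ k / real n"
proof (cases "\<exists>\<sigma>\<in>perm_tuples k n. compatible \<sigma> f")
  case False
  then have "{\<sigma> \<in> perm_tuples k n. compatible \<sigma> f} = {}" by blast
  then have "prob k n f = 0" unfolding prob_def by (simp only: card.empty of_nat_0 div_0)
  then show ?thesis by simp
next
  case True
  then obtain \<sigma>0 where \<sigma>0: "\<sigma>0 \<in> perm_tuples k n" "compatible \<sigma>0 f" by blast
  define E where "E = (\<Sum>i=1..k. card (sources f i))"
  note bij = perm_tuples_bij[OF \<sigma>0(1)]
  have "card (f ` Pos) \<le> E"
    unfolding E_def using vertices_le_edges[OF \<sigma>0(2) _ w] bij by simp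
  moreover have "card (f ` Pos) \<noteq> E"
    unfolding E_def using inj_if_vertices_eq_edges[OF \<sigma>0(2) _ w] bij f by auto
  ultimately have E: "Suc (card (f ` Pos)) \<le> E" by simp
  have "prob k n f * real n ^ Suc (card (f ` Pos)) \<le> prob k n f * real n ^ E"
    using n E by (intro mult_left_mono power_increasing) (auto simp: prob_def)
  also have "\<dots> = (\<Prod>i=1..k. agree_prob n (card (sources f i)) * real n ^ card (sources f i))"
    unfolding prob_def compatible_prob[OF w f(1) \<sigma>0] by (simp add: prod.distrib E_def power_sum)
  also have "\<dots> \<le> (\<Prod>i=1..k. 2)"
    using agree_prob_pos less_imp_le by (intro prod_mono) (auto intro!: small card_sources_le mult_nonneg_nonneg)
  finally show ?thesis using n by (simp add: field_simps)
qed

text \<open>The maps are grouped by the number \<open>v\<close> of vertices. At most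
  \<open>n ^ v * v ^ N\<close> maps have \<open>v\<close> vertices, each of probability at most
  \<open>2 ^ k / n ^ (v + 1)\<close>, so each of the boundedly many groups contributes
  \<open>O(1 / n)\<close>.\<close>

lemma noninjective_part:
  assumes w: "set w \<subseteq> {1..k} \<times> UNIV"
  shows "(\<lambda>n. \<Sum>f\<in>{f \<in> Pos \<rightarrow>\<^sub>E {1..n}. inj_on f Base \<and> \<not> inj_on f Pos}. prob k n f) \<longlonglongrightarrow> 0"
proof (rule tendsto_sandwich)
  define N where "N = card Pos"
  show "(\<lambda>n. 0) \<longlonglongrightarrow> (0::real)" by simp
  show "(\<lambda>n. (\<Sum>v\<le>N. real v ^ N) * 2 ^ k / real n) \<longlonglongrightarrow> 0"
    by (intro real_tendsto_divide_at_top[OF tendsto_const] filterlim_real_sequentially)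
  show "\<forall>\<^sub>F n in sequentially. 0 \<le> (\<Sum>f\<in>{f \<in> Pos \<rightarrow>\<^sub>E {1..n}. inj_on f Base \<and> \<not> inj_on f Pos}. prob k n f)"
    by (simp add: prob_def sum_nonneg)
  have "\<forall>\<^sub>F n in sequentially. \<forall>e\<in>{..N}. agree_prob n e * real n ^ e < 2"
    by (intro eventually_ball_finite ballI order_tendstoD(2)[OF agree_prob_asymp]) auto
  then show "\<forall>\<^sub>F n in sequentially. (\<Sum>f\<in>{f \<in> Pos \<rightarrow>\<^sub>E {1..n}. inj_on f Base \<and> \<not> inj_on f Pos}. prob k n f)
      \<le> (\<Sum>v\<le>N. real v ^ N) * 2 ^ k / real n"
    using eventually_gt_at_top[of 0]
  proof eventually_elim
    case (elim n)
    let ?B = "{f \<in> Pos \<rightarrow>\<^sub>E {1..n}. inj_on f Base \<and> \<not> inj_on f Pos}"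
    have le: "prob k n f \<le> 2 ^ k / (real n * real n ^ card (f ` Pos))" if "f \<in> ?B" for f
    proof -
      have "prob k n f * real n ^ card (f ` Pos) \<le> 2 ^ k / real n"
        using that elim by (intro compatible_prob_le w) (auto simp: N_def intro: less_imp_le)
      then show ?thesis using elim by (simp add: field_simps)
    qed
    have "(\<Sum>f\<in>?B. prob k n f) \<le> (\<Sum>f\<in>?B. 2 ^ k / (real n * real n ^ card (f ` Pos)))"
      by (intro sum_mono le)
    also have "\<dots> \<le> (\<Sum>f\<in>Pos \<rightarrow>\<^sub>E {1..n}. 2 ^ k / (real n * real n ^ card (f ` Pos)))"
      by (intro sum_mono2) auto
    also have "\<dots> = (\<Sum>v\<le>N. \<Sum>f\<in>{f \<in> Pos \<rightarrow>\<^sub>E {1..n}. card (f ` Pos) = v}. 2 ^ k / (real n * real n ^ card (f ` Pos)))"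
      by (rule sum.group[symmetric]) (auto simp: N_def card_image_le)
    also have "\<dots> \<le> (\<Sum>v\<le>N. real v ^ N * 2 ^ k / real n)"
    proof (rule sum_mono)
      fix v
      have "real (card {f \<in> Pos \<rightarrow>\<^sub>E {1..n}. card (f ` Pos) = v}) \<le> real (n ^ v * v ^ N)"
        using card_funcset_image_le[of Pos "{1..n}" v] unfolding N_def by (intro of_nat_mono) simp
      then have "real (card {f \<in> Pos \<rightarrow>\<^sub>E {1..n}. card (f ` Pos) = v}) * (2 ^ k / (real n * real n ^ v))
          \<le> real (n ^ v * v ^ N) * (2 ^ k / (real n * real n ^ v))"
        by (intro mult_right_mono) auto
      also have "\<dots> = real v ^ N * 2 ^ k / real n" using elim by simp
      finally show "(\<Sum>f\<in>{f \<in> Pos \<rightarrow>\<^sub>E {1..n}. card (f ` Pos) = v}. 2 ^ k / (real n * real n ^ card (f ` Pos)))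
          \<le> real v ^ N * 2 ^ k / real n" by simp
    qed
    also have "\<dots> = (\<Sum>v\<le>N. real v ^ N) * 2 ^ k / real n"
      by (simp add: sum_distrib_right sum_divide_distrib)
    finally show ?case .
  qed
qed

lemma expected_closed_trajectories_limit:
  assumes w: "set w \<subseteq> {1..k} \<times> UNIV"
  shows "(\<lambda>n. (\<Sum>\<sigma>\<in>perm_tuples k n. real (card (closed_trajectories n \<sigma>))) / real (card (perm_tuples k n))) \<longlonglongrightarrow> 1"
proof -
  have "Base \<subseteq> Pos" by (auto simp: Base_def)
  have "(\<Sum>f\<in>{f \<in> Pos \<rightarrow>\<^sub>E {1..n}. inj_on f Base}. prob k n f) =
     (\<Sum>f\<in>{f \<in> Pos \<rightarrow>\<^sub>E {1..n}. inj_on f Pos}. prob k n f) +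
     (\<Sum>f\<in>{f \<in> Pos \<rightarrow>\<^sub>E {1..n}. inj_on f Base \<and> \<not> inj_on f Pos}. prob k n f)" for n
    using \<open>Base \<subseteq> Pos\<close>
    by (subst sum.union_disjoint[symmetric]) (auto intro!: sum.cong intro: inj_on_subset)
  then show ?thesis
    unfolding expected_closed_trajectories
    using tendsto_add[OF injective_part[OF w] noninjective_part[OF w]] by simp
qed

end

section \<open>Cycles\<close>

text \<open>All three facts come from identifying the size of the orbit with the first return time
  \<open>funpow_dist1 p x x\<close>.\<close>

lemma orbit_period:
  assumes "permutation p"
  shows orbit_eq_funpow_image: "orbit p x = (\<lambda>s. (p ^^ s) x) ` {..<card (orbit p x)}"
    and inj_on_funpow_period: "inj_on (\<lambda>s. (p ^^ s) x) {..<card (orbit p x)}"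
    and funpow_period: "(p ^^ card (orbit p x)) x = x"
proof -
  have self: "x \<in> orbit p x" using assms by (rule permutation_self_in_orbit)
  have c: "card (orbit p x) = funpow_dist1 p x x"
    by (subst orbit_conv_funpow_dist1[OF self], subst card_image[OF inj_on_funpow_dist1[OF self]]) simp
  show "orbit p x = (\<lambda>s. (p ^^ s) x) ` {..<card (orbit p x)}"
    unfolding c lessThan_atLeast0 by (rule orbit_conv_funpow_dist1[OF self])
  show "inj_on (\<lambda>s. (p ^^ s) x) {..<card (orbit p x)}"
    unfolding c lessThan_atLeast0 by (rule inj_on_funpow_dist1[OF self])
  show "(p ^^ card (orbit p x)) x = x"
    unfolding c by (rule funpow_dist1_prop[OF self])
qed

lemma finite_orbit_permutation: "permutation p \<Longrightarrow> finite (orbit p x)"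
  by (intro finite_orbit permutation_self_in_orbit)

lemma card_orbit_pos: "permutation p \<Longrightarrow> card (orbit p x) > 0"
  using finite_orbit_permutation[of p x] orbit_nonempty[of p x] by (simp add: card_gt_0_iff)

lemma orbit_eq_iff:
  assumes "permutation p"
  shows "y \<in> orbit p x \<longleftrightarrow> orbit p y = orbit p x"
  using assms cyclic_on_orbit'[OF assms, of x] orbit_cyclic_eq3 permutation_self_in_orbit by metis

lemma funpow_mod_period:
  assumes "permutation p"
  shows "(p ^^ (m mod card (orbit p x))) x = (p ^^ m) x"
  using funpow_period[OF assms] by (rule funpow_mod_eq)

lemma funpow_fixed_iff:
  assumes "permutation p"
  shows "(p ^^ m) x = x \<longleftrightarrow> card (orbit p x) dvd m"
proof
  let ?c = "card (orbit p x)"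
  assume "(p ^^ m) x = x"
  then have "(p ^^ (m mod ?c)) x = (p ^^ 0) x" by (simp add: funpow_mod_period[OF assms])
  then have "m mod ?c = 0"
    using inj_on_funpow_period[OF assms, of x] card_orbit_pos[OF assms, of x] unfolding inj_on_def
    by (metis lessThan_iff mod_less_divisor)
  then show "?c dvd m" by auto
next
  let ?c = "card (orbit p x)"
  assume "?c dvd m"
  then have "m mod ?c = 0" by simp
  then show "(p ^^ m) x = x" using funpow_mod_period[OF assms, of m x] by simp
qed

lemma funpow_in_orbit_permutation: "permutation p \<Longrightarrow> (p ^^ m) x \<in> orbit p x"
  by (intro funpow_in_orbit permutation_self_in_orbit)

lemma permutation_funpow: "permutation p \<Longrightarrow> permutation (p ^^ d)"
  by (induction d) (auto intro: permutation_compose)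

text \<open>Both sides have the same multiples \<open>m\<close>: they are those for which the orbit
  size of \<open>x\<close> under \<open>p\<close> divides \<open>d * m\<close>.\<close>

lemma card_orbit_funpow:
  assumes "permutation p" "d > 0"
  shows "card (orbit (p ^^ d) x) = card (orbit p x) div gcd (card (orbit p x)) d"
proof -
  define M where "M = card (orbit p x)"
  define g where "g = gcd M d"
  have M: "M > 0" using card_orbit_pos[OF assms(1)] by (simp add: M_def)
  have g: "g > 0" using M by (simp add: g_def)
  have "card (orbit (p ^^ d) x) dvd m \<longleftrightarrow> M div g dvd m" for m
  proof -
    have "card (orbit (p ^^ d) x) dvd m \<longleftrightarrow> M dvd d * m"
      unfolding M_def funpow_fixed_iff[OF permutation_funpow[OF assms(1)], symmetric]
        funpow_fixed_iff[OF assms(1), symmetric] by (simp add: funpow_mult mult.commute)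
    also have "\<dots> \<longleftrightarrow> g * (M div g) dvd g * ((d div g) * m)"
      by (simp add: g_def flip: mult.assoc)
    also have "\<dots> \<longleftrightarrow> M div g dvd (d div g) * m" using g by simp
    also have "\<dots> \<longleftrightarrow> M div g dvd m"
      using div_gcd_coprime[of M d] M unfolding g_def by (simp add: coprime_dvd_mult_right_iff)
    finally show ?thesis .
  qed
  then show ?thesis unfolding M_def[symmetric] g_def[symmetric] by (metis dvd_antisym dvd_refl)
qed

text \<open>The cycles of length \<open>L\<close> partition the points lying on them into blocks of
  size \<open>L\<close>. Counting points reduces later comparisons of cycle counts to orbit
  sizes.\<close>

lemma num_cycles_eq_points:
  assumes p: "p permutes {1..n}"
  shows "L * num_cycles n L p = card {x \<in> {1..n}. card (orbit p x) = L}"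
proof -
  have perm: "permutation p" using p by (auto simp: permutation_permutes)
  let ?C = "{C. (\<exists>x\<in>{1..n}. C = orbit p x) \<and> card C = L}"
  have U: "\<Union>?C = {x \<in> {1..n}. card (orbit p x) = L}"
  proof safe
    fix y x assume y: "y \<in> orbit p x" and x: "x \<in> {1..n}" "L = card (orbit p x)"
    then show "y \<in> {1..n}" using permutes_orbit_subset[OF p x(1)] by blast
    show "card (orbit p y) = card (orbit p x)" using y orbit_eq_iff[OF perm] by metis
  next
    fix x assume "x \<in> {1..n}" "L = card (orbit p x)"
    then show "x \<in> \<Union> {C. (\<exists>x\<in>{1..n}. C = orbit p x) \<and> card C = card (orbit p x)}"
      using permutation_self_in_orbit[OF perm] by blast
  qed
  have "L * card ?C = card (\<Union>?C)"
  proof (rule card_partition)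
    show "finite ?C" by (rule finite_subset[of _ "orbit p ` {1..n}"]) auto
    show "finite (\<Union>?C)" unfolding U by simp
    show "c1 \<inter> c2 = {}" if "c1 \<in> ?C" "c2 \<in> ?C" "c1 \<noteq> c2" for c1 c2
      using that orbit_eq_iff[OF perm] by blast
  qed simp
  then show ?thesis unfolding num_cycles_def U .
qed

lemma num_cycles_conj:
  assumes p: "p permutes {1..n}" and q: "q permutes {1..n}" and L: "L > 0"
  shows "num_cycles n L (q \<circ> p \<circ> inv' q) = num_cycles n L p"
proof -
  let ?p = "q \<circ> p \<circ> inv' q"
  have perm: "permutation p" using p by (auto simp: permutation_permutes)
  have p': "?p permutes {1..n}" using p q by (intro permutes_compose permutes_inv)
  have orb: "orbit ?p (q x) = q ` orbit p x" for x
    using orbit_inverse[OF permutation_self_in_orbit[OF perm], of x ?p q] permutes_inverses(2)[OF q]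
    by simp
  have card: "card (orbit ?p (q x)) = card (orbit p x)" for x
    unfolding orb by (rule card_image) (rule permutes_inj_on[OF q])
  have "{x \<in> {1..n}. card (orbit ?p x) = L} = q ` {x \<in> {1..n}. card (orbit p x) = L}"
  proof (intro equalityI subsetI)
    fix y assume y: "y \<in> {x \<in> {1..n}. card (orbit ?p x) = L}"
    define x where "x = inv' q y"
    have "y = q x" using permutes_inverses(1)[OF q] by (simp add: x_def)
    moreover have "x \<in> {1..n}" using y permutes_in_image[OF permutes_inv[OF q]] by (simp add: x_def)
    ultimately show "y \<in> q ` {x \<in> {1..n}. card (orbit p x) = L}" using y card by auto
  next
    fix y assume "y \<in> q ` {x \<in> {1..n}. card (orbit p x) = L}"
    then show "y \<in> {x \<in> {1..n}. card (orbit ?p x) = L}"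
      using card permutes_in_image[OF q] by auto
  qed
  then have "card {x \<in> {1..n}. card (orbit ?p x) = L} = card {x \<in> {1..n}. card (orbit p x) = L}"
    by (simp add: card_image permutes_inj_on[OF q])
  then have "L * num_cycles n L ?p = L * num_cycles n L p"
    by (simp only: num_cycles_eq_points[OF p] num_cycles_eq_points[OF p'])
  then show ?thesis using L by simp
qed

lemma finite_H_set: "d > 0 \<Longrightarrow> finite (H_set d L)"
  by (rule finite_subset[of _ "{..d}"]) (auto simp: H_set_def dest: dvd_imp_le)

text \<open>The witness \<open>h\<close> is \<open>gcd M d\<close>: then \<open>M div h = L\<close>
  and \<open>d div h\<close> are coprime, which is the condition defining
  \<open>H_set\<close>.\<close>

lemma div_gcd_eq_iff:
  assumes "d > 0" "L > 0"
  shows "M div gcd M d = L \<longleftrightarrow> (\<exists>h\<in>H_set d L. M = L * h)"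
proof
  assume L: "M div gcd M d = L"
  define h where "h = gcd M d"
  have h: "h > 0" "h dvd d" "h dvd M" using assms by (auto simp: h_def)
  have "coprime (d div h) L"
    using div_gcd_coprime[of d M] assms unfolding L[symmetric] h_def by (simp add: gcd.commute)
  then have "h \<in> H_set d L" using h by (simp add: H_set_def coprime_iff_gcd_eq_1)
  moreover have "M = L * h" using L h by (auto simp: h_def)
  ultimately show "\<exists>h\<in>H_set d L. M = L * h" by blast
next
  assume "\<exists>h\<in>H_set d L. M = L * h"
  then obtain h where h: "h > 0" "h dvd d" "gcd (d div h) L = 1" "M = L * h"
    by (auto simp: H_set_def)
  have "gcd M d = gcd (h * L) (h * (d div h))" using h by (simp add: mult.commute)
  also have "\<dots> = h" using h by (subst gcd_mult_left) (simp add: gcd.commute)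
  finally show "M div gcd M d = L" using h by simp
qed

text \<open>A point has period \<open>L\<close> under \<open>p ^^ d\<close> iff its period under
  \<open>p\<close> is \<open>L * h\<close> with \<open>h \<in> H_set d L\<close>. Counting these
  points and cancelling \<open>L\<close> gives the formula.\<close>

lemma num_cycles_funpow:
  assumes p: "p permutes {1..n}" and d: "d > 0" and L: "L > 0"
  shows "num_cycles n L (p ^^ d) = (\<Sum>h\<in>H_set d L. h * num_cycles n (L * h) p)"
proof -
  have perm: "permutation p" using p by (auto simp: permutation_permutes)
  have pd: "p ^^ d permutes {1..n}" using p by (rule permutes_funpow)
  have "L * num_cycles n L (p ^^ d) = card {x \<in> {1..n}. card (orbit (p ^^ d) x) = L}"
    by (rule num_cycles_eq_points[OF pd])
  also have "{x \<in> {1..n}. card (orbit (p ^^ d) x) = L} =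
      (\<Union>h\<in>H_set d L. {x \<in> {1..n}. card (orbit p x) = L * h})"
    unfolding card_orbit_funpow[OF perm d] div_gcd_eq_iff[OF d L] by blast
  also have "card \<dots> = (\<Sum>h\<in>H_set d L. card {x \<in> {1..n}. card (orbit p x) = L * h})"
    using finite_H_set[OF d] L by (intro card_UN_disjoint) auto
  also have "\<dots> = (\<Sum>h\<in>H_set d L. L * h * num_cycles n (L * h) p)"
    by (simp only: num_cycles_eq_points[OF p, symmetric])
  also have "\<dots> = L * (\<Sum>h\<in>H_set d L. h * num_cycles n (L * h) p)"
    by (simp add: sum_distrib_left mult.assoc)
  finally show ?thesis using L by simp
qed

section \<open>Word maps\<close>

definition word_act :: "(nat \<Rightarrow> 'a \<Rightarrow> 'a) \<Rightarrow> letter list \<Rightarrow> 'a \<Rightarrow> 'a" where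
  "word_act \<sigma> w = foldr (\<lambda>a g. letter_act \<sigma> a \<circ> g) w id"

lemma word_act_simps [simp]: "word_act \<sigma> [] = id" "word_act \<sigma> (a # w) = letter_act \<sigma> a \<circ> word_act \<sigma> w"
  by (simp_all add: word_act_def)

lemma word_act_append: "word_act \<sigma> (v @ w) = word_act \<sigma> v \<circ> word_act \<sigma> w"
  by (induction v) (simp_all add: comp_assoc)

lemma word_subst_eq_word_act:
  assumes "\<sigma> \<in> perm_tuples k n"
  shows "word_subst (sym_group n) \<sigma> w = word_act \<sigma> w"
proof -
  have "\<sigma> i \<in> carrier (sym_group n)" for i
    using perm_tuples_permutes[OF assms] by (simp add: sym_group_def)
  then have "inv\<^bsub>sym_group n\<^esub> (\<sigma> i) = inv' (\<sigma> i)" for i by simp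
  then have "(if snd a then \<sigma> (fst a) else inv\<^bsub>sym_group n\<^esub> (\<sigma> (fst a))) = letter_act \<sigma> a" for a
    by (simp add: letter_act_def)
  then show ?thesis
    by (simp only: word_subst_def word_act_def sym_group_mult sym_group_one)
qed

lemma letter_act_permutes:
  "\<sigma> \<in> perm_tuples k n \<Longrightarrow> letter_act \<sigma> a permutes {1..n}"
  using perm_tuples_permutes permutes_inv unfolding letter_act_def by metis

lemma word_act_permutes:
  "\<sigma> \<in> perm_tuples k n \<Longrightarrow> word_act \<sigma> w permutes {1..n}"
proof (induction w)
  case (Cons a w)
  then show ?case unfolding word_act_simps by (intro permutes_compose letter_act_permutes)
qed (simp add: permutes_id)

lemma word_act_inv_word:
  assumes "\<sigma> \<in> perm_tuples k n"
  shows "word_act \<sigma> (inv_word w) = inv' (word_act \<sigma> w)"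
proof -
  have cancel: "word_act \<sigma> (inv_word w) (word_act \<sigma> w x) = x" for x
  proof (induction w arbitrary: x)
    case (Cons a w)
    have "inv_word (a # w) = inv_word w @ [inv_letter a]" by (simp add: inv_word_def)
    then show ?case
      using Cons letter_act_inv_letter[OF perm_tuples_bij[OF assms]] by (simp add: word_act_append)
  qed (simp add: inv_word_def)
  show ?thesis
  proof
    fix y
    show "word_act \<sigma> (inv_word w) y = inv' (word_act \<sigma> w) y"
      using cancel[of "inv' (word_act \<sigma> w) y"] permutes_inverses(1)[OF word_act_permutes[OF assms]]
      by simp
  qed
qed


text \<open>Lists of \<open>r\<close> distinct cycles with prescribed lengths, each with a marked point.\<close>

definition cycle_tuples :: "nat \<Rightarrow> (nat \<Rightarrow> nat) \<Rightarrow> nat \<Rightarrow> (nat \<Rightarrow> nat) \<Rightarrow> (nat \<Rightarrow> nat) set" where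
  "cycle_tuples n p r M = {x \<in> {..<r} \<rightarrow>\<^sub>E {1..n}.
     (\<forall>j<r. card (orbit p (x j)) = M j) \<and> inj_on (\<lambda>j. orbit p (x j)) {..<r}}"

text \<open>Letters are applied from left to right, whereas \<open>word_act\<close> applies the last
  letter first. Hence the reversed words in what follows.\<close>

primrec trajectory :: "letter list \<Rightarrow> (nat \<Rightarrow> 'a \<Rightarrow> 'a) \<Rightarrow> nat \<Rightarrow> 'a \<Rightarrow> 'a" where
  "trajectory w \<sigma> 0 x = x"
| "trajectory w \<sigma> (Suc t) x = letter_act \<sigma> (cyclic_letter w (int t)) (trajectory w \<sigma> t x)"

lemma trajectory_add:
  "t \<le> length w \<Longrightarrow>
    trajectory w \<sigma> (length w * s + t) x = word_act \<sigma> (rev (take t w)) (trajectory w \<sigma> (length w * s) x)"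
proof (induction t)
  case (Suc t)
  have "cyclic_letter w (int (length w * s + t)) = w ! t"
    using Suc.prems by (simp add: cyclic_letter_def flip: of_nat_mult of_nat_add zmod_int)
  then show ?case using Suc by (simp add: take_Suc_conv_app_nth)
qed simp

lemma trajectory_mult: "trajectory w \<sigma> (length w * s) x = (word_act \<sigma> (rev w) ^^ s) x"
proof (induction s)
  case (Suc s)
  have "trajectory w \<sigma> (length w * Suc s) x = trajectory w \<sigma> (length w * s + length w) x"
    by (simp add: add.commute)
  then show ?case using Suc trajectory_add[of "length w" w \<sigma> s x] by simp
qed simp

section \<open>Closed trajectories and tuples of marked cycles\<close>

context trajectories
begin

lemma closed_trajectory_eq_trajectory:
  assumes f: "f \<in> closed_trajectories n \<sigma>" and j: "j < r"
  shows "int s < len j \<Longrightarrow> f (j, int s) = trajectory w \<sigma> s (f (j, 0))"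
    and "trajectory w \<sigma> (length w * M j) (f (j, 0)) = f (j, 0)"
proof -
  have step: "letter_act \<sigma> (cyclic_letter w (int s)) (f (j, int s)) = f (j, (int s + 1) mod len j)"
    if "int s < len j" for s
  proof -
    have "(j, int s) \<in> Pos" using that j by (auto simp: Pos_def)
    then have "letter_act \<sigma> (lab (j, int s)) (f (j, int s)) = f (succ (j, int s))"
      using f unfolding closed_trajectories_def compatible_def by blast
    then show ?thesis by (simp add: lab_def succ_def)
  qed
  have *: "f (j, int s) = trajectory w \<sigma> s (f (j, 0))" if "int s < len j" for s
    using that
  proof (induction s)
    case (Suc s)
    then have "f (j, (int s + 1) mod len j) = f (j, int (Suc s))"
      by (simp add: mod_pos_pos_trivial add.commute)
    then show ?case using Suc step[of s] by simp
  qed simp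
  then show "int s < len j \<Longrightarrow> f (j, int s) = trajectory w \<sigma> s (f (j, 0))" .
  have "length w * M j > 0" using word_nonempty period_pos[OF j] by simp
  then obtain m where m: "length w * M j = Suc m" using gr0_implies_Suc by blast
  then have len: "len j = int m + 1" by (simp add: len_def)
  show "trajectory w \<sigma> (length w * M j) (f (j, 0)) = f (j, 0)"
    using step[of m] *[of m] by (simp add: m len)
qed

lemma base_in: "j < r \<Longrightarrow> s < M j \<Longrightarrow> (j, int (length w * s)) \<in> Base"
  using word_nonempty by (auto simp: Base_def Pos_def len_def)

lemma baseE:
  assumes "p \<in> Base"
  obtains j s where "p = (j, int (length w * s))" "j < r" "s < M j"
proof -
  obtain j y where p: "p = (j, y)" "j < r" "0 \<le> y" "y < len j" "int (length w) dvd y"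
    using assms by (auto simp: Base_def Pos_def)
  then obtain z where z: "y = int (length w) * z" by blast
  have w: "int (length w) > 0" using word_nonempty by simp
  then have "z \<ge> 0" using p(3) z by (simp add: zero_le_mult_iff)
  then obtain s where s: "z = int s" using nonneg_int_cases by blast
  then have "s < M j" using p(4) w z by (auto simp: len_def)
  then show thesis using that[of j s] p z s by simp
qed

text \<open>A closed trajectory is determined by its starting points, and injectivity on
  \<open>Base\<close> says that these lie on distinct cycles of the prescribed exact
  lengths.\<close>

lemma card_closed_trajectories:
  assumes \<sigma>: "\<sigma> \<in> perm_tuples k n"
  shows "card (closed_trajectories n \<sigma>) = card (cycle_tuples n (word_act \<sigma> (rev w)) r M)"
proof -
  define p where "p = word_act \<sigma> (rev w)"
  define to_pts where "to_pts f = restrict (\<lambda>j. f (j, 0)) {..<r}" for f :: "nat \<times> int \<Rightarrow> nat"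
  define of_pts where "of_pts x = restrict (\<lambda>q. trajectory w \<sigma> (nat (snd q)) (x (fst q))) Pos" for x :: "nat \<Rightarrow> nat"
  have "p permutes {1..n}" unfolding p_def using \<sigma> by (rule word_act_permutes)
  then have perm: "permutation p" by (auto simp: permutation_permutes)
  have pos0: "(j, 0) \<in> Pos" if "j < r" for j using that len_pos[of j] by (auto simp: Pos_def)
  have "bij_betw to_pts (closed_trajectories n \<sigma>) (cycle_tuples n p r M)"
  proof (rule bij_betw_byWitness[where f' = of_pts])
    show "\<forall>f\<in>closed_trajectories n \<sigma>. of_pts (to_pts f) = f"
    proof
      fix f assume f: "f \<in> closed_trajectories n \<sigma>"
      show "of_pts (to_pts f) = f"
      proof
        fix q :: "nat \<times> int"
        show "of_pts (to_pts f) q = f q"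
        proof (cases "q \<in> Pos")
          case True
          then obtain j y where q: "q = (j, y)" "j < r" "0 \<le> y" "y < len j" by (auto simp: Pos_def)
          then show ?thesis using True closed_trajectory_eq_trajectory(1)[OF f q(2), of "nat y"]
            by (simp add: of_pts_def to_pts_def)
        next
          case False
          have "f \<in> Pos \<rightarrow>\<^sub>E {1..n}" using f by (simp add: closed_trajectories_def)
          from PiE_arb[OF this False] show ?thesis using False by (simp add: of_pts_def)
        qed
      qed
    qed
    show "\<forall>x\<in>cycle_tuples n p r M. to_pts (of_pts x) = x"
    proof
      fix x assume "x \<in> cycle_tuples n p r M"
      then have "x \<in> {..<r} \<rightarrow>\<^sub>E {1..n}" by (simp add: cycle_tuples_def)
      from PiE_arb[OF this] show "to_pts (of_pts x) = x"
        using pos0 by (auto simp: to_pts_def of_pts_def fun_eq_iff)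
    qed
    show "to_pts ` closed_trajectories n \<sigma> \<subseteq> cycle_tuples n p r M"
    proof
      fix x assume "x \<in> to_pts ` closed_trajectories n \<sigma>"
      then obtain f where f: "f \<in> closed_trajectories n \<sigma>" and x: "x = to_pts f" by blast
      have f': "f \<in> Pos \<rightarrow>\<^sub>E {1..n}" "inj_on f Base" using f by (auto simp: closed_trajectories_def)
      have xj: "x j = f (j, 0)" if "j < r" for j using that by (simp add: x to_pts_def)
      have pow: "(p ^^ s) (x j) = f (j, int (length w * s))" if "j < r" "s < M j" for j s
        using closed_trajectory_eq_trajectory(1)[OF f that(1), of "length w * s"] that word_nonempty
        by (simp add: trajectory_mult p_def xj len_def flip: of_nat_mult)
      have inj: "j = j' \<and> s = s'" if "j < r" "s < M j" "j' < r" "s' < M j'" "(p ^^ s) (x j) = (p ^^ s') (x j')" for j s j' s'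
        using inj_onD[OF f'(2) _ base_in[OF that(1,2)] base_in[OF that(3,4)]] that pow word_nonempty
        by (auto simp flip: of_nat_mult)
      have dvd: "card (orbit p (x j)) dvd M j" if "j < r" for j
        unfolding funpow_fixed_iff[OF perm, symmetric]
        using closed_trajectory_eq_trajectory(2)[OF f that] that by (simp add: trajectory_mult p_def xj)
      \<comment> \<open>A shorter period \<open>c\<close> would identify the base points of index
        \<open>c\<close> and 0 of the same trajectory.\<close>
      have per: "card (orbit p (x j)) = M j" if j: "j < r" for j
      proof (rule ccontr)
        assume "card (orbit p (x j)) \<noteq> M j"
        then have "card (orbit p (x j)) < M j"
          using dvd[OF j] period_pos[OF j] by (meson dvd_imp_le le_neq_implies_less)
        then show False
          using inj[OF j _ j, of "card (orbit p (x j))" 0] funpow_period[OF perm, of "x j"]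
            card_orbit_pos[OF perm, of "x j"] period_pos[OF j] by simp
      qed
      \<comment> \<open>If two starting points shared a cycle, one of them would be a base point of
        the other trajectory.\<close>
      have "inj_on (\<lambda>j. orbit p (x j)) {..<r}"
      proof (rule inj_onI)
        fix i j assume ij: "i \<in> {..<r}" "j \<in> {..<r}" "orbit p (x i) = orbit p (x j)"
        then have "x j \<in> (\<lambda>s. (p ^^ s) (x i)) ` {..<M i}"
          using orbit_eq_funpow_image[OF perm, of "x i"] permutation_self_in_orbit[OF perm, of "x j"] per[of i]
          by simp
        then obtain s where "s < M i" "(p ^^ s) (x i) = (p ^^ 0) (x j)" by auto
        then show "i = j" using inj[of i s j 0] ij period_pos[of j] by auto
      qed
      moreover have "x \<in> {..<r} \<rightarrow>\<^sub>E {1..n}"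
        using PiE_mem[OF f'(1) pos0] by (auto simp: x to_pts_def)
      ultimately show "x \<in> cycle_tuples n p r M" using per by (simp add: cycle_tuples_def)
    qed
    show "of_pts ` cycle_tuples n p r M \<subseteq> closed_trajectories n \<sigma>"
    proof
      fix f assume "f \<in> of_pts ` cycle_tuples n p r M"
      then obtain x where x: "x \<in> cycle_tuples n p r M" and f: "f = of_pts x" by blast
      have per: "card (orbit p (x j)) = M j" "x j \<in> {1..n}" if "j < r" for j
        using x that by (auto simp: cycle_tuples_def)
      have inj: "inj_on (\<lambda>j. orbit p (x j)) {..<r}" using x by (simp add: cycle_tuples_def)
      have fx: "f (j, int t) = trajectory w \<sigma> t (x j)" if "j < r" "int t < len j" for j t
        using that by (simp add: f of_pts_def Pos_def)
      have tr: "trajectory w \<sigma> t y \<in> {1..n}" if "y \<in> {1..n}" for t y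
        using that permutes_in_image[OF letter_act_permutes[OF \<sigma>]] by (induction t) auto
      have "f \<in> Pos \<rightarrow>\<^sub>E {1..n}"
        using tr per(2) by (auto simp: f of_pts_def Pos_def)
      moreover have "inj_on f Base"
      proof (rule inj_onI)
        fix q q' assume "q \<in> Base" "q' \<in> Base" and eq: "f q = f q'"
        then obtain j s j' s' where q: "q = (j, int (length w * s))" "j < r" "s < M j"
          "q' = (j', int (length w * s'))" "j' < r" "s' < M j'"
          by (metis baseE)
        have "(p ^^ s) (x j) = (p ^^ s') (x j')"
          using eq q fx[of j "length w * s"] fx[of j' "length w * s'"] word_nonempty
          by (simp add: len_def trajectory_mult p_def flip: of_nat_mult)
        moreover from this have "orbit p (x j) = orbit p (x j')"
          using funpow_in_orbit_permutation[OF perm] orbit_eq_iff[OF perm] by metis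
        then have "j = j'" using inj q by (auto simp: inj_on_def)
        ultimately show "q = q'"
          using inj_on_funpow_period[OF perm, of "x j"] per(1)[of j] q by (auto simp: inj_on_def)
      qed
      moreover have "compatible \<sigma> f"
        unfolding compatible_def
      proof
        fix q assume "q \<in> Pos"
        then obtain j t where q: "q = (j, int t)" "j < r" "int t < len j"
          by (auto simp: Pos_def elim!: nonneg_int_cases)
        have act: "letter_act \<sigma> (lab q) (f q) = trajectory w \<sigma> (Suc t) (x j)"
          using q by (simp add: fx lab_def)
        show "letter_act \<sigma> (lab q) (f q) = f (succ q)"
        proof (cases "int (Suc t) < len j")
          case True
          then have "succ q = (j, int (Suc t))" by (simp add: q(1) succ_def)
          then show ?thesis unfolding act using fx[OF q(2) True] by simp
        next
          case False
          \<comment> \<open>The last letter closes the trajectory: \<open>p ^^ M j\<close> has then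
            been applied to \<open>x j\<close>, and this fixes \<open>x j\<close>.\<close>
          then have last: "int (Suc t) = len j" using q(3) by simp
          then have "Suc t = length w * M j" unfolding len_def by (simp only: of_nat_eq_iff)
          then have "letter_act \<sigma> (lab q) (f q) = (p ^^ M j) (x j)"
            unfolding act by (simp only: trajectory_mult p_def)
          also have "\<dots> = x j" using funpow_period[OF perm, of "x j"] per(1)[OF q(2)] by simp
          also have "\<dots> = f (j, int 0)" using fx[OF q(2), of 0] len_pos[OF q(2)] by simp
          also have "(j, int 0) = succ q" using last by (simp add: q(1) succ_def add.commute)
          finally show ?thesis .
        qed
      qed
      ultimately show "f \<in> closed_trajectories n \<sigma>" by (simp add: closed_trajectories_def)
    qed
  qed
  then show ?thesis by (simp add: bij_betw_same_card p_def)
qed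

end

section \<open>Truncated expansion of a product\<close>

text \<open>The elementary symmetric polynomial of degree \<open>r\<close> in the values
  \<open>z c\<close>.\<close>

definition esym :: "nat \<Rightarrow> 'b set \<Rightarrow> ('b \<Rightarrow> 'a::comm_semiring_1) \<Rightarrow> 'a" where
  "esym r K z = (\<Sum>A\<in>{A. A \<subseteq> K \<and> card A = r}. \<Prod>c\<in>A. z c)"

lemma esym_0 [simp]: "finite K \<Longrightarrow> esym 0 K z = 1"
proof -
  assume "finite K"
  then have "{A. A \<subseteq> K \<and> card A = 0} = {{}}" by (auto dest: finite_subset)
  then show ?thesis by (simp add: esym_def)
qed

lemma esym_empty [simp]: "esym (Suc r) {} z = 0"
proof -
  have none: "{A. A \<subseteq> {} \<and> card A = Suc r} = {}" by auto
  show ?thesis unfolding esym_def none by simp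
qed

lemma esym_insert:
  assumes "finite K" "x \<notin> K"
  shows "esym (Suc r) (insert x K) z = esym (Suc r) K z + z x * esym r K z"
proof -
  let ?A = "{A. A \<subseteq> K \<and> card A = Suc r}" and ?B = "{A. A \<subseteq> K \<and> card A = r}"
  have fin: "finite A" if "A \<subseteq> K" for A using that assms(1) by (rule finite_subset)
  have "{A. A \<subseteq> insert x K \<and> card A = Suc r} = ?A \<union> insert x ` ?B"
  proof (intro equalityI subsetI)
    fix A assume A: "A \<in> {A. A \<subseteq> insert x K \<and> card A = Suc r}"
    show "A \<in> ?A \<union> insert x ` ?B"
    proof (cases "x \<in> A")
      case True
      then have "A = insert x (A - {x})" "A - {x} \<in> ?B" using A by auto
      then show ?thesis by blast
    qed (use A in auto)
  next
    fix A assume "A \<in> ?A \<union> insert x ` ?B"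
    then show "A \<in> {A. A \<subseteq> insert x K \<and> card A = Suc r}"
      using fin assms(2) by (auto simp: subset_iff card_insert_if)
  qed
  moreover have "inj_on (insert x) ?B" using assms(2) by (auto simp: inj_on_def)
  moreover have "(\<Prod>c\<in>insert x A. z c) = z x * (\<Prod>c\<in>A. z c)" if "A \<in> ?B" for A
    using that fin assms(2) by (subst prod.insert) auto
  moreover have "?A \<inter> insert x ` ?B = {}" using assms(2) by auto
  ultimately show ?thesis
    using assms(1) by (simp add: esym_def sum.union_disjoint sum.reindex sum_distrib_left)
qed

text \<open>A Bonferroni-type inequality: \<open>esym_insert\<close> bounds the error at order \<open>R\<close> by those at orders \<open>R\<close> and \<open>R - 1\<close>.\<close>

lemma prod_truncation:
  fixes z :: "'b \<Rightarrow> complex"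
  assumes "finite K" and z: "\<And>c. norm (1 + z c) \<le> 1"
  shows "norm ((\<Prod>c\<in>K. 1 + z c) - (\<Sum>r<R. esym r K z)) \<le> esym R K (\<lambda>c. norm (z c))"
  using assms(1)
proof (induction K arbitrary: R rule: finite_induct)
  case empty
  show ?case
  proof (cases R)
    case (Suc R')
    have "(\<Sum>r<Suc R'. esym r {} z) = 1" by (simp add: sum.lessThan_Suc_shift del: sum.lessThan_Suc)
    then show ?thesis using Suc by simp
  qed simp
next
  case (insert x K)
  show ?case
  proof (cases R)
    \<comment> \<open>At order 0 the sum is empty and the error is the product itself; the bound on
      \<open>1 + z c\<close> enters here.\<close>
    case 0
    have "norm (\<Prod>c\<in>insert x K. 1 + z c) \<le> 1"
      unfolding prod_norm[symmetric] using z by (intro prod_le_1) auto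
    then show ?thesis using 0 insert.hyps by simp
  next
    case (Suc R')
    have "(\<Sum>r<Suc R'. esym r (insert x K) z) =
        (\<Sum>r<Suc R'. esym r K z) + z x * (\<Sum>r<R'. esym r K z)"
      using insert.hyps by (simp add: sum.lessThan_Suc_shift esym_insert sum.distrib sum_distrib_left
          del: sum.lessThan_Suc)
    then have "(\<Prod>c\<in>insert x K. 1 + z c) - (\<Sum>r<R. esym r (insert x K) z) =
        ((\<Prod>c\<in>K. 1 + z c) - (\<Sum>r<R. esym r K z)) + z x * ((\<Prod>c\<in>K. 1 + z c) - (\<Sum>r<R'. esym r K z))"
      using insert.hyps Suc by (simp add: algebra_simps del: sum.lessThan_Suc)
    also have "norm \<dots> \<le> esym R K (\<lambda>c. norm (z c)) + norm (z x) * esym R' K (\<lambda>c. norm (z c))"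
      by (intro order.trans[OF norm_triangle_ineq] add_mono insert.IH)
        (simp add: norm_mult mult_left_mono insert.IH)
    finally show ?thesis using insert.hyps Suc by (simp add: esym_insert)
  qed
qed

text \<open>Each subset of size \<open>r\<close> is enumerated by \<open>fact r\<close> injective
  tuples, all with the same product.\<close>

lemma esym_eq_sum_tuples:
  assumes "finite K"
  shows "fact r * esym r K z = (\<Sum>f\<in>{f \<in> {..<r} \<rightarrow>\<^sub>E K. inj_on f {..<r}}. \<Prod>j<r. z (f j))"
proof -
  let ?F = "{f \<in> {..<r} \<rightarrow>\<^sub>E K. inj_on f {..<r}}" and ?T = "{A. A \<subseteq> K \<and> card A = r}"
  have "(\<Sum>f\<in>?F. \<Prod>j<r. z (f j)) = (\<Sum>A\<in>?T. \<Sum>f\<in>{f \<in> ?F. f ` {..<r} = A}. \<Prod>j<r. z (f j))"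
  proof (rule sum.group[symmetric])
    show "finite ?F" using assms by (intro finite_subset[OF _ finite_PiE[of "{..<r}" "\<lambda>_. K"]]) auto
    show "(\<lambda>f. f ` {..<r}) ` ?F \<subseteq> ?T"
    proof (rule image_subsetI)
      fix f assume "f \<in> ?F"
      then have "f ` {..<r} \<subseteq> K" "card (f ` {..<r}) = r" by (simp_all add: card_image PiE_iff image_subset_iff)
      then show "f ` {..<r} \<in> ?T" by simp
    qed
    show "finite ?T" using assms by (intro finite_subset[of ?T "Pow K"]) auto
  qed
  also have "\<dots> = (\<Sum>A\<in>?T. fact r * (\<Prod>c\<in>A. z c))"
  proof (rule sum.cong[OF refl])
    fix A assume A: "A \<in> ?T"
    then have finA: "finite A" using assms finite_subset by blast
    have eq: "{f \<in> ?F. f ` {..<r} = A} = {f \<in> {..<r} \<rightarrow>\<^sub>E A. inj_on f {..<r}}"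
    proof (intro equalityI subsetI)
      fix f assume f: "f \<in> {f \<in> {..<r} \<rightarrow>\<^sub>E A. inj_on f {..<r}}"
      then have "f ` {..<r} \<subseteq> A" by auto
      moreover have "card (f ` {..<r}) = card A" using f A by (simp add: card_image)
      ultimately have "f ` {..<r} = A" using finA by (intro card_subset_eq)
      then show "f \<in> {f \<in> ?F. f ` {..<r} = A}" using f A by auto
    qed auto
    have "(\<Sum>f\<in>{f \<in> ?F. f ` {..<r} = A}. \<Prod>j<r. z (f j)) = (\<Sum>f\<in>{f \<in> ?F. f ` {..<r} = A}. \<Prod>c\<in>A. z c)"
    proof (rule sum.cong[OF refl])
      fix f assume "f \<in> {f \<in> ?F. f ` {..<r} = A}"
      then have "inj_on f {..<r}" "A = f ` {..<r}" by simp_all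
      then show "(\<Prod>j<r. z (f j)) = (\<Prod>c\<in>A. z c)" by (simp add: prod.reindex)
    qed
    moreover have "card {f \<in> {..<r} \<rightarrow>\<^sub>E A. inj_on f {..<r}} = fact r"
    proof -
      have "prod ((-) r) {0..<r} = (\<Prod>i=1..r. i)"
        by (rule prod.reindex_bij_witness[of _ "\<lambda>i. r - i" "\<lambda>i. r - i"]) auto
      then show ?thesis
        using card_inj_on_subset_funcset[of "{..<r}" A "{..<r}"] finA A by (simp add: fact_prod)
    qed
    ultimately show "(\<Sum>f\<in>{f \<in> ?F. f ` {..<r} = A}. \<Prod>j<r. z (f j)) = fact r * (\<Prod>c\<in>A. z c)"
      unfolding eq by simp
  qed
  finally show ?thesis by (simp add: esym_def sum_distrib_left)
qed

section \<open>Symmetric functions of the cycles\<close>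

definition cycles_in :: "nat \<Rightarrow> (nat \<Rightarrow> nat) \<Rightarrow> nat set \<Rightarrow> nat set set" where
  "cycles_in n p S = {C. (\<exists>x\<in>{1..n}. C = orbit p x) \<and> card C \<in> S}"

lemma finite_cycles_in [simp]: "finite (cycles_in n p S)"
  by (rule finite_subset[of _ "orbit p ` {1..n}"]) (auto simp: cycles_in_def)

text \<open>A tuple of distinct cycles of lengths \<open>M j\<close> admits
  \<open>\<Prod>j<r. M j\<close> choices of marked points, which the weights \<open>1 / M j\<close>
  compensate. The weighted sum over marked points is grouped first by the cycles and then by their
  lengths.\<close>

lemma esym_cycles:
  fixes \<zeta> :: "nat \<Rightarrow> 'a::field_char_0"
  assumes p: "p permutes {1..n}" and S: "finite S"
  shows "fact r * esym r (cycles_in n p S) (\<lambda>C. \<zeta> (card C)) =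
    (\<Sum>M\<in>{..<r} \<rightarrow>\<^sub>E S. (\<Prod>j<r. \<zeta> (M j) / of_nat (M j)) * of_nat (card (cycle_tuples n p r M)))"
proof -
  have perm: "permutation p" using p by (auto simp: permutation_permutes)
  let ?K = "cycles_in n p S"
  let ?F = "{f \<in> {..<r} \<rightarrow>\<^sub>E ?K. inj_on f {..<r}}"
  define X where "X = {x \<in> {..<r} \<rightarrow>\<^sub>E {1..n}. (\<forall>j<r. card (orbit p (x j)) \<in> S) \<and>
    inj_on (\<lambda>j. orbit p (x j)) {..<r}}"
  define wt where "wt x = (\<Prod>j<r. \<zeta> (card (orbit p (x j))) / of_nat (card (orbit p (x j))))" for x :: "nat \<Rightarrow> nat"
  define orb where "orb x = restrict (\<lambda>j. orbit p (x j)) {..<r}" for x :: "nat \<Rightarrow> nat"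
  define per where "per x = restrict (\<lambda>j. card (orbit p (x j))) {..<r}" for x :: "nat \<Rightarrow> nat"
  have finX: "finite X"
    unfolding X_def by (intro finite_subset[OF _ finite_PiE[of "{..<r}" "\<lambda>_. {1..n}"]]) auto
  have "(\<Sum>x\<in>X. wt x) = (\<Sum>f\<in>?F. \<Sum>x\<in>{x \<in> X. orb x = f}. wt x)"
  proof (rule sum.group[symmetric, OF finX])
    show "finite ?F" by (intro finite_subset[OF _ finite_PiE[of "{..<r}" "\<lambda>_. ?K"]]) auto
    show "orb ` X \<subseteq> ?F" by (auto simp: X_def orb_def cycles_in_def inj_on_def)
  qed
  also have "\<dots> = (\<Sum>f\<in>?F. \<Prod>j<r. \<zeta> (card (f j)))"
  proof (rule sum.cong[OF refl])
    fix f assume f: "f \<in> ?F"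
    then have K: "f j \<in> ?K" if "j < r" for j using that by auto
    have mem: "y \<in> f j \<longleftrightarrow> y \<in> {1..n} \<and> orbit p y = f j" if j: "j < r" for j y
    proof -
      obtain z where z: "z \<in> {1..n}" "f j = orbit p z" using K[OF j] by (auto simp: cycles_in_def)
      then show ?thesis
        using orbit_eq_iff[OF perm, of y z] permutes_orbit_subset[OF p z(1)] by auto
    qed
    have pos: "card (f j) > 0" if "j < r" for j
      using K[OF that] card_orbit_pos[OF perm] by (auto simp: cycles_in_def)
    \<comment> \<open>The fibre over a tuple of cycles consists of all choices of one point on
      each.\<close>
    have eq: "{x \<in> X. orb x = f} = PiE {..<r} f"
    proof (intro equalityI subsetI)
      fix x assume x: "x \<in> {x \<in> X. orb x = f}"
      then have xX: "x \<in> {..<r} \<rightarrow>\<^sub>E {1..n}" and ox: "orb x = f" by (auto simp: X_def)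
      show "x \<in> PiE {..<r} f"
      proof (rule PiE_I)
        fix j assume "j \<in> {..<r}"
        then show "x j \<in> f j" using mem[of j "x j"] PiE_mem[OF xX, of j] by (simp flip: ox add: orb_def)
      next
        fix j assume "j \<notin> {..<r}"
        then show "x j = undefined" by (rule PiE_arb[OF xX])
      qed
    next
      fix x assume x: "x \<in> PiE {..<r} f"
      have xj: "x j \<in> {1..n}" "orbit p (x j) = f j" if "j < r" for j
        using mem[OF that, of "x j"] PiE_mem[OF x, of j] that by auto
      have "x \<in> {..<r} \<rightarrow>\<^sub>E {1..n}" using xj(1) PiE_arb[OF x] by (intro PiE_I) auto
      moreover have "inj_on (\<lambda>j. orbit p (x j)) {..<r}"
        using f xj(2) by (auto simp: inj_on_def)
      moreover have "\<forall>j<r. card (orbit p (x j)) \<in> S" using xj(2) K by (auto simp: cycles_in_def)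
      ultimately have "x \<in> X" by (simp add: X_def)
      moreover have "orb x = f"
      proof
        fix j
        show "orb x j = f j"
        proof (cases "j < r")
          case False
          then have "f j = undefined" using f by (intro PiE_arb[of f "{..<r}"]) auto
          then show ?thesis using False by (simp add: orb_def)
        qed (simp add: orb_def xj)
      qed
      ultimately show "x \<in> {x \<in> X. orb x = f}" by simp
    qed
    have "wt x = (\<Prod>j<r. \<zeta> (card (f j)) / of_nat (card (f j)))" if "x \<in> {x \<in> X. orb x = f}" for x
    proof -
      have "orbit p (x j) = f j" if "j < r" for j
        using \<open>x \<in> _\<close> that by (auto simp: orb_def)
      then show ?thesis unfolding wt_def by (intro prod.cong) auto
    qed
    then have "(\<Sum>x\<in>{x \<in> X. orb x = f}. wt x) =
      of_nat (card (PiE {..<r} f)) * (\<Prod>j<r. \<zeta> (card (f j)) / of_nat (card (f j)))"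
      unfolding eq by simp
    also have "\<dots> = (\<Prod>j<r. of_nat (card (f j)) * (\<zeta> (card (f j)) / of_nat (card (f j))))"
      by (simp only: card_PiE[OF finite_lessThan] of_nat_prod prod.distrib)
    also have "\<dots> = (\<Prod>j<r. \<zeta> (card (f j)))"
      using pos by (intro prod.cong) auto
    finally show "(\<Sum>x\<in>{x \<in> X. orb x = f}. wt x) = (\<Prod>j<r. \<zeta> (card (f j)))" .
  qed
  also have "\<dots> = fact r * esym r ?K (\<lambda>C. \<zeta> (card C))"
    by (rule esym_eq_sum_tuples[symmetric]) simp
  finally have 1: "(\<Sum>x\<in>X. wt x) = fact r * esym r ?K (\<lambda>C. \<zeta> (card C))" .
  have "(\<Sum>x\<in>X. wt x) = (\<Sum>M\<in>{..<r} \<rightarrow>\<^sub>E S. \<Sum>x\<in>{x \<in> X. per x = M}. wt x)"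
  proof (rule sum.group[symmetric, OF finX])
    show "finite ({..<r} \<rightarrow>\<^sub>E S)" using S by (intro finite_PiE) auto
    show "per ` X \<subseteq> {..<r} \<rightarrow>\<^sub>E S" by (auto simp: X_def per_def)
  qed
  also have "\<dots> = (\<Sum>M\<in>{..<r} \<rightarrow>\<^sub>E S. (\<Prod>j<r. \<zeta> (M j) / of_nat (M j)) * of_nat (card (cycle_tuples n p r M)))"
  proof (rule sum.cong[OF refl])
    fix M assume M: "M \<in> {..<r} \<rightarrow>\<^sub>E S"
    have "per x = M \<longleftrightarrow> (\<forall>j<r. card (orbit p (x j)) = M j)" for x
    proof -
      have "per x j = M j" if "\<not> j < r" for j using that PiE_arb[OF M, of j] by (simp add: per_def)
      then show ?thesis by (auto simp: fun_eq_iff per_def)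
    qed
    moreover have "M j \<in> S" if "j < r" for j using M that by auto
    ultimately have eq: "{x \<in> X. per x = M} = cycle_tuples n p r M"
      by (auto simp: X_def cycle_tuples_def)
    have "wt x = (\<Prod>j<r. \<zeta> (M j) / of_nat (M j))" if "x \<in> cycle_tuples n p r M" for x
      using that unfolding wt_def by (intro prod.cong) (auto simp: cycle_tuples_def)
    then show "(\<Sum>x\<in>{x \<in> X. per x = M}. wt x) =
      (\<Prod>j<r. \<zeta> (M j) / of_nat (M j)) * of_nat (card (cycle_tuples n p r M))"
      unfolding eq by simp
  qed
  finally show ?thesis using 1 by simp
qed

section \<open>Convergence of the characteristic functions\<close>

text \<open>Polymorphic because complex means yield characteristic functions and real means their
  error bounds.\<close>

definition perm_mean :: "nat \<Rightarrow> nat \<Rightarrow> ((nat \<Rightarrow> nat \<Rightarrow> nat) \<Rightarrow> 'a::real_normed_field) \<Rightarrow> 'a" where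
  "perm_mean k n g = (\<Sum>\<sigma>\<in>perm_tuples k n. g \<sigma>) / of_nat (card (perm_tuples k n))"

lemma perm_mean_cong: "(\<And>\<sigma>. \<sigma> \<in> perm_tuples k n \<Longrightarrow> g \<sigma> = h \<sigma>) \<Longrightarrow> perm_mean k n g = perm_mean k n h"
  by (simp add: perm_mean_def)

text \<open>The limit is 1 for every \<open>M\<close>: the factors \<open>1 / M j\<close> of the
  unmarked moments are absorbed by the \<open>M j\<close> choices of a marked point.\<close>

lemma perm_mean_cycle_tuples:
  assumes v: "cyclically_reduced v" "\<not> proper_power v" "set v \<subseteq> {1..k} \<times> UNIV"
    and M: "\<And>j. j < r \<Longrightarrow> M j > 0"
  shows "(\<lambda>n. perm_mean k n (\<lambda>\<sigma>. of_nat (card (cycle_tuples n (word_act \<sigma> v) r M)) :: 'a::real_normed_field)) \<longlonglongrightarrow> 1"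
proof -
  \<comment> \<open>Trajectories read from left to right, so \<open>rev v\<close> makes them follow
    \<open>word_act \<sigma> v\<close>.\<close>
  interpret trajectories "rev v" r M
  proof
    show "cyclically_reduced (rev v)"
      using v not_proper_power_nonempty by (intro cyclically_reduced_rev) auto
    show "\<not> proper_power (rev v)" using v(2) proper_power_rev by blast
  qed (rule M)
  have "perm_mean k n (\<lambda>\<sigma>. of_nat (card (cycle_tuples n (word_act \<sigma> v) r M)) :: 'a) =
    of_real ((\<Sum>\<sigma>\<in>perm_tuples k n. real (card (closed_trajectories n \<sigma>))) / real (card (perm_tuples k n)))" for n
    unfolding perm_mean_def by (simp add: card_closed_trajectories)
  moreover have "(\<lambda>n. (\<Sum>\<sigma>\<in>perm_tuples k n. real (card (closed_trajectories n \<sigma>))) / real (card (perm_tuples k n))) \<longlonglongrightarrow> 1"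
    by (rule expected_closed_trajectories_limit) (use v in simp)
  ultimately show ?thesis using tendsto_of_real[of _ 1] by (metis (no_types, lifting) ext of_real_1)
qed

text \<open>In the limit every length pattern \<open>M\<close> contributes just its weight
  \<open>\<Prod>j<r. \<zeta> (M j) / M j\<close>, and the sum of these over all patterns factors
  into an \<open>r\<close>-th power.\<close>

lemma perm_mean_esym:
  fixes \<zeta> :: "nat \<Rightarrow> 'a::real_normed_field"
  assumes v: "cyclically_reduced v" "\<not> proper_power v" "set v \<subseteq> {1..k} \<times> UNIV"
    and S: "finite S" "0 \<notin> S"
  shows "(\<lambda>n. perm_mean k n (\<lambda>\<sigma>. esym r (cycles_in n (word_act \<sigma> v) S) (\<lambda>C. \<zeta> (card C))))
    \<longlonglongrightarrow> (\<Sum>m\<in>S. \<zeta> m / of_nat m) ^ r / fact r"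
proof -
  define c where "c M = (\<Prod>j<r. \<zeta> (M j) / of_nat (M j))" for M
  have "esym r (cycles_in n (word_act \<sigma> v) S) (\<lambda>C. \<zeta> (card C)) =
      (\<Sum>M\<in>{..<r} \<rightarrow>\<^sub>E S. c M * of_nat (card (cycle_tuples n (word_act \<sigma> v) r M))) / fact r"
    if "\<sigma> \<in> perm_tuples k n" for \<sigma> n
    using esym_cycles[OF word_act_permutes[OF that, of v] S(1), of r \<zeta>] by (simp add: c_def field_simps)
  then have "perm_mean k n (\<lambda>\<sigma>. esym r (cycles_in n (word_act \<sigma> v) S) (\<lambda>C. \<zeta> (card C))) =
      perm_mean k n (\<lambda>\<sigma>. (\<Sum>M\<in>{..<r} \<rightarrow>\<^sub>E S. c M * of_nat (card (cycle_tuples n (word_act \<sigma> v) r M))) / fact r)" for n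
    by (rule perm_mean_cong)
  also have "\<dots> n = (\<Sum>M\<in>{..<r} \<rightarrow>\<^sub>E S. c M * perm_mean k n (\<lambda>\<sigma>. of_nat (card (cycle_tuples n (word_act \<sigma> v) r M)))) / fact r" for n
    unfolding perm_mean_def
    by (simp add: sum_divide_distrib sum_distrib_left sum.swap[of _ _ "perm_tuples k n"] mult_ac divide_divide_eq_left)
  finally have eq: "perm_mean k n (\<lambda>\<sigma>. esym r (cycles_in n (word_act \<sigma> v) S) (\<lambda>C. \<zeta> (card C))) =
    (\<Sum>M\<in>{..<r} \<rightarrow>\<^sub>E S. c M * perm_mean k n (\<lambda>\<sigma>. of_nat (card (cycle_tuples n (word_act \<sigma> v) r M)))) / fact r" for n .
  have "(\<lambda>n. (\<Sum>M\<in>{..<r} \<rightarrow>\<^sub>E S. c M * perm_mean k n (\<lambda>\<sigma>. of_nat (card (cycle_tuples n (word_act \<sigma> v) r M)))) / fact r)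
    \<longlonglongrightarrow> (\<Sum>M\<in>{..<r} \<rightarrow>\<^sub>E S. c M * 1) / fact r"
  proof (intro tendsto_divide tendsto_sum tendsto_mult tendsto_const perm_mean_cycle_tuples v)
    fix M j assume "M \<in> {..<r} \<rightarrow>\<^sub>E S" "j < r"
    then have "M j \<in> S" by auto
    then show "M j > 0" using S(2) by (metis gr0I)
  qed simp
  also have "(\<Sum>M\<in>{..<r} \<rightarrow>\<^sub>E S. c M * 1) = (\<Prod>j<r. \<Sum>m\<in>S. \<zeta> m / of_nat m)"
    unfolding c_def using S(1) by (subst prod_sum_PiE) auto
  finally show ?thesis by (simp add: eq)
qed

text \<open>A three-term estimate: the order \<open>R\<close> is fixed first, so that both limits
  are within \<open>\<eta> / 3\<close>, and only then is \<open>n\<close> taken large.\<close>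

lemma tendsto_by_truncation:
  fixes a :: "nat \<Rightarrow> 'a::real_normed_vector"
  assumes s: "\<And>R. (\<lambda>n. s R n) \<longlonglongrightarrow> \<sigma> R" and e: "\<And>R. (\<lambda>n. e R n) \<longlonglongrightarrow> \<epsilon> R"
    and bound: "\<And>R n. norm (a n - s R n) \<le> e R n"
    and lim: "\<sigma> \<longlonglongrightarrow> l" "\<epsilon> \<longlonglongrightarrow> 0"
  shows "a \<longlonglongrightarrow> l"
proof (rule LIMSEQ_I)
  fix \<eta> :: real assume \<eta>: "\<eta> > 0"
  then have \<eta>3: "\<eta> / 3 > 0" by simp
  have "eventually (\<lambda>R. dist (\<sigma> R) l < \<eta> / 3 \<and> \<epsilon> R < \<eta> / 3) sequentially"
    by (intro eventually_conj tendstoD[OF lim(1) \<eta>3] order_tendstoD(2)[OF lim(2) \<eta>3])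
  then obtain R where R: "dist (\<sigma> R) l < \<eta> / 3" "\<epsilon> R < \<eta> / 3"
    using eventually_happens by force
  have "eventually (\<lambda>n. dist (s R n) (\<sigma> R) < \<eta> / 3 \<and> e R n < \<eta> / 3) sequentially"
    by (intro eventually_conj tendstoD[OF s \<eta>3] order_tendstoD(2)[OF e R(2)])
  then have "eventually (\<lambda>n. norm (a n - l) < \<eta>) sequentially"
  proof eventually_elim
    case (elim n)
    have "dist (a n) l \<le> dist (a n) (s R n) + dist (s R n) (\<sigma> R) + dist (\<sigma> R) l"
      using dist_triangle[of "a n" l "s R n"] dist_triangle[of "s R n" l "\<sigma> R"] by linarith
    then show ?case using bound[of n R] R elim unfolding dist_norm by linarith
  qed
  then show "\<exists>no. \<forall>n\<ge>no. norm (a n - l) < \<eta>" by (simp add: eventually_sequentially)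
qed

text \<open>The truncated expansions converge to partial sums of the exponential series, and their
  errors to \<open>\<Lambda> ^ R / fact R\<close>, which vanishes as \<open>R\<close> grows.\<close>

lemma perm_mean_prod_cycles:
  fixes \<zeta> :: "nat \<Rightarrow> complex"
  assumes v: "cyclically_reduced v" "\<not> proper_power v" "set v \<subseteq> {1..k} \<times> UNIV"
    and S: "finite S" "0 \<notin> S" and \<zeta>: "\<And>m. norm (1 + \<zeta> m) \<le> 1"
  shows "(\<lambda>n. perm_mean k n (\<lambda>\<sigma>. \<Prod>C\<in>cycles_in n (word_act \<sigma> v) S. 1 + \<zeta> (card C)))
    \<longlonglongrightarrow> exp (\<Sum>m\<in>S. \<zeta> m / of_nat m)"
proof (rule tendsto_by_truncation)
  let ?K = "\<lambda>n \<sigma>. cycles_in n (word_act \<sigma> v) S"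
  define \<mu> where "\<mu> = (\<Sum>m\<in>S. \<zeta> m / of_nat m)"
  define \<Lambda> where "\<Lambda> = (\<Sum>m\<in>S. norm (\<zeta> m) / of_nat m)"
  show "(\<lambda>n. \<Sum>r<R. perm_mean k n (\<lambda>\<sigma>. esym r (?K n \<sigma>) (\<lambda>C. \<zeta> (card C)))) \<longlonglongrightarrow> (\<Sum>r<R. \<mu> ^ r / fact r)" for R
    unfolding \<mu>_def by (intro tendsto_sum perm_mean_esym v S)
  show "(\<lambda>n. perm_mean k n (\<lambda>\<sigma>. esym R (?K n \<sigma>) (\<lambda>C. norm (\<zeta> (card C))))) \<longlonglongrightarrow> \<Lambda> ^ R / fact R" for R
    unfolding \<Lambda>_def by (rule perm_mean_esym[OF v S])
  show "(\<lambda>R. \<Sum>r<R. \<mu> ^ r / fact r) \<longlonglongrightarrow> exp (\<Sum>m\<in>S. \<zeta> m / of_nat m)"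
    using exp_converges[of \<mu>] by (simp add: sums_def \<mu>_def scaleR_conv_of_real field_simps)
  show "(\<lambda>R. \<Lambda> ^ R / fact R) \<longlonglongrightarrow> 0"
    using summable_LIMSEQ_zero[OF summable_exp[of \<Lambda>]] by (simp add: field_simps)
  fix R n
  have "perm_mean k n (\<lambda>\<sigma>. \<Prod>C\<in>?K n \<sigma>. 1 + \<zeta> (card C)) - (\<Sum>r<R. perm_mean k n (\<lambda>\<sigma>. esym r (?K n \<sigma>) (\<lambda>C. \<zeta> (card C))))
    = (\<Sum>\<sigma>\<in>perm_tuples k n. (\<Prod>C\<in>?K n \<sigma>. 1 + \<zeta> (card C)) - (\<Sum>r<R. esym r (?K n \<sigma>) (\<lambda>C. \<zeta> (card C)))) / of_nat (card (perm_tuples k n))"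
    unfolding perm_mean_def by (subst sum_subtractf, subst sum.swap) (simp add: diff_divide_distrib sum_divide_distrib)
  also have "norm \<dots> \<le> perm_mean k n (\<lambda>\<sigma>. esym R (?K n \<sigma>) (\<lambda>C. norm (\<zeta> (card C))))"
    unfolding norm_divide perm_mean_def norm_of_nat
    by (intro divide_right_mono sum_norm_le prod_truncation \<zeta>) auto
  finally show "norm (perm_mean k n (\<lambda>\<sigma>. \<Prod>C\<in>?K n \<sigma>. 1 + \<zeta> (card C)) -
      (\<Sum>r<R. perm_mean k n (\<lambda>\<sigma>. esym r (?K n \<sigma>) (\<lambda>C. \<zeta> (card C)))))
    \<le> perm_mean k n (\<lambda>\<sigma>. esym R (?K n \<sigma>) (\<lambda>C. norm (\<zeta> (card C))))" .
qed

section \<open>From the word to its primitive core\<close>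

lemma sym_group_nat_pow: "p [^]\<^bsub>sym_group n\<^esub> (d::nat) = p ^^ d"
proof (induction d)
  case 0
  then show ?case by (simp add: sym_group_one)
next
  case (Suc d)
  then show ?case by (simp add: sym_group_mult funpow_Suc_right del: funpow.simps)
qed

text \<open>Substitution is a homomorphism, so the word becomes the \<open>d\<close>-th power of a
  conjugate of \<open>word_act \<sigma> v\<close>. The power is resolved by
  \<open>num_cycles_funpow\<close>, and conjugation preserves cycle counts.\<close>

lemma cycle_count_power:
  assumes \<sigma>: "\<sigma> \<in> perm_tuples k n" and u: "u \<in> carrier (free_group k)" "u = c @ v @ inv_word c"
    and dL: "d > 0" "L > 0"
  shows "cycle_count (u [^]\<^bsub>free_group k\<^esub> d) L n \<sigma> =
    (\<Sum>h\<in>H_set d L. h * num_cycles n (L * h) (word_act \<sigma> v))"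
proof -
  interpret group_hom "free_group k" "sym_group n" "word_subst (sym_group n) \<sigma>"
  proof (intro group_hom.intro group_hom_axioms.intro group_free_group sym_group_is_group word_subst_hom)
    show "\<sigma> i \<in> carrier (sym_group n)" for i
      using perm_tuples_permutes[OF \<sigma>] by (simp add: sym_group_def)
  qed
  define q p where "q = word_act \<sigma> c" and "p = word_act \<sigma> v"
  have q: "q permutes {1..n}" and p: "p permutes {1..n}"
    using word_act_permutes[OF \<sigma>] by (auto simp: q_def p_def)
  have "word_subst (sym_group n) \<sigma> (u [^]\<^bsub>free_group k\<^esub> d) = word_act \<sigma> u ^^ d"
    using hom_nat_pow[OF u(1), of d] by (simp add: sym_group_nat_pow word_subst_eq_word_act[OF \<sigma>])
  also have "word_act \<sigma> u = q \<circ> p \<circ> inv' q"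
    by (simp add: u(2) word_act_append word_act_inv_word[OF \<sigma>] q_def p_def comp_assoc)
  finally have "cycle_count (u [^]\<^bsub>free_group k\<^esub> d) L n \<sigma> = num_cycles n L ((q \<circ> p \<circ> inv' q) ^^ d)"
    by (simp only: cycle_count_def)
  also have "\<dots> = (\<Sum>h\<in>H_set d L. h * num_cycles n (L * h) (q \<circ> p \<circ> inv' q))"
    using p q dL by (intro num_cycles_funpow permutes_compose permutes_inv)
  also have "\<dots> = (\<Sum>h\<in>H_set d L. h * num_cycles n (L * h) p)"
    using dL by (intro sum.cong refl) (simp add: num_cycles_conj[OF p q] H_set_def)
  finally show ?thesis by (simp add: p_def)
qed

lemma prod_cycles_in:
  assumes "finite S"
  shows "(\<Prod>C\<in>cycles_in n p S. g (card C)) = (\<Prod>m\<in>S. g m ^ num_cycles n m p)"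
proof -
  have "(\<Prod>C\<in>cycles_in n p S. g (card C)) = (\<Prod>m\<in>S. \<Prod>C\<in>{C \<in> cycles_in n p S. card C = m}. g (card C))"
    by (rule prod.group[symmetric]) (use assms in \<open>auto simp: cycles_in_def\<close>)
  also have "\<dots> = (\<Prod>m\<in>S. g m ^ num_cycles n m p)"
  proof (rule prod.cong[OF refl])
    fix m assume "m \<in> S"
    then have "{C \<in> cycles_in n p S. card C = m} = {C. (\<exists>x\<in>{1..n}. C = orbit p x) \<and> card C = m}"
      by (auto simp: cycles_in_def)
    moreover have "(\<Prod>C\<in>{C \<in> cycles_in n p S. card C = m}. g (card C)) = (\<Prod>C\<in>{C \<in> cycles_in n p S. card C = m}. g m)"
      by (rule prod.cong) auto
    ultimately show "(\<Prod>C\<in>{C \<in> cycles_in n p S. card C = m}. g (card C)) = g m ^ num_cycles n m p"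
      by (simp only: prod_constant num_cycles_def)
  qed
  finally show ?thesis .
qed

section \<open>Characteristic functions of both laws\<close>

lemma real_distribution_cycle_count_law: "real_distribution (cycle_count_law k w L n)"
  unfolding cycle_count_law_def by (intro prob_space.real_distribution_distr) (auto intro: prob_space_measure_pmf)

lemma real_distribution_limit_law: "real_distribution (limit_law d L)"
  unfolding limit_law_def by (intro prob_space.real_distribution_distr) (auto intro: prob_space_measure_pmf)

lemma char_cycle_count_law:
  "char (cycle_count_law k w L n) t = perm_mean k n (\<lambda>\<sigma>. iexp (t * real (cycle_count w L n \<sigma>)))"
proof -
  have "char (cycle_count_law k w L n) t =
      (CLINT \<sigma>|measure_pmf (pmf_of_set (perm_tuples k n)). iexp (t * real (cycle_count w L n \<sigma>)))"
    unfolding char_def cycle_count_law_def random_perms_eq by (subst integral_distr) auto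
  also have "\<dots> = perm_mean k n (\<lambda>\<sigma>. iexp (t * real (cycle_count w L n \<sigma>)))"
    by (subst integral_measure_pmf[of "perm_tuples k n"])
      (auto simp: perm_mean_def scaleR_conv_of_real sum_divide_distrib)
  finally show ?thesis .
qed

text \<open>The probability generating function of the Poisson law, evaluated on the closed unit
  disc.\<close>

lemma integral_poisson_power:
  fixes z :: complex
  assumes "rate > 0" "norm z \<le> 1"
  shows "(LINT m|measure_pmf (poisson_pmf rate). z ^ m) = exp (of_real rate * (z - 1))"
proof -
  have "integrable (measure_pmf (poisson_pmf rate)) (\<lambda>m. z ^ m)"
    using assms by (intro measure_pmf.integrable_const_bound[of _ 1]) (auto simp: norm_power power_le_one)
  then have "integrable (count_space UNIV) (\<lambda>m. pmf (poisson_pmf rate) m *\<^sub>R z ^ m)"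
    unfolding measure_pmf_eq_density by (subst (asm) integrable_density) auto
  then have "(\<lambda>m. pmf (poisson_pmf rate) m *\<^sub>R z ^ m) sums (LINT m|count_space UNIV. pmf (poisson_pmf rate) m *\<^sub>R z ^ m)"
    by (rule sums_integral_count_space_nat)
  also have "(LINT m|count_space UNIV. pmf (poisson_pmf rate) m *\<^sub>R z ^ m) = (LINT m|measure_pmf (poisson_pmf rate). z ^ m)"
    unfolding measure_pmf_eq_density by (subst integral_density) auto
  finally have 1: "(\<lambda>m. pmf (poisson_pmf rate) m *\<^sub>R z ^ m) sums (LINT m|measure_pmf (poisson_pmf rate). z ^ m)" .
  have "(\<lambda>m. exp (- of_real rate) * ((of_real rate * z) ^ m /\<^sub>R fact m)) sums (exp (- of_real rate) * exp (of_real rate * z))"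
    by (intro sums_mult exp_converges)
  also have "(\<lambda>m. exp (- of_real rate) * ((of_real rate * z) ^ m /\<^sub>R fact m)) = (\<lambda>m. pmf (poisson_pmf rate) m *\<^sub>R z ^ m)"
    using assms(1) by (simp add: fun_eq_iff scaleR_conv_of_real power_mult_distrib field_simps flip: exp_of_real of_real_minus)
  also have "exp (- of_real rate) * exp (of_real rate * z) = exp (of_real rate * (z - 1))"
    by (simp add: algebra_simps flip: exp_add)
  finally show ?thesis using 1 sums_unique2 by blast
qed

lemma iexp_of_nat_mult: "iexp (x * real m) = iexp x ^ m"
  by (simp add: exp_of_nat_mult[symmetric] algebra_simps)

text \<open>Independence turns the characteristic function into a product of Poisson generating
  functions at \<open>iexp (t * real h)\<close>.\<close>

lemma char_limit_law:
  assumes "d > 0" "L > 0"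
  shows "char (limit_law d L) t = exp (\<Sum>h\<in>H_set d L. (iexp (t * real h) - 1) / of_nat (L * h))"
proof -
  let ?p = "\<lambda>h. poisson_pmf (1 / (real L * real h))"
  let ?P = "measure_pmf (Pi_pmf (H_set d L) 0 ?p)"
  have fin: "finite (H_set d L)" using assms(1) by (rule finite_H_set)
  have "prob_space.indep_vars ?P (\<lambda>_. count_space UNIV) (\<lambda>h Z. Z h) (H_set d L)"
    by (rule indep_vars_Pi_pmf[OF fin])
  then have indep: "prob_space.indep_vars ?P (\<lambda>_. borel) (\<lambda>h Z. real h * real (Z h)) (H_set d L)"
    by (rule prob_space.indep_vars_compose2[OF prob_space_measure_pmf, where Y = "\<lambda>h m. real h * real m"]) auto
  have "limit_law d L = distr ?P borel (\<lambda>Z. \<Sum>h\<in>H_set d L. real h * real (Z h))"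
    unfolding limit_law_def by simp
  then have "char (limit_law d L) t = (\<Prod>h\<in>H_set d L. char (distr ?P borel (\<lambda>Z. real h * real (Z h))) t)"
    using prob_space.char_distr_sum[OF prob_space_measure_pmf indep, of t] by simp
  also have "\<dots> = (\<Prod>h\<in>H_set d L. exp ((iexp (t * real h) - 1) / of_nat (L * h)))"
  proof (rule prod.cong[OF refl])
    fix h assume h: "h \<in> H_set d L"
    then have rate: "1 / (real L * real h) > 0" using assms by (auto simp: H_set_def)
    have "char (distr ?P borel (\<lambda>Z. real h * real (Z h))) t = (CLINT Z|?P. iexp (t * real h) ^ Z h)"
      unfolding char_def iexp_of_nat_mult[symmetric] by (subst integral_distr) (auto simp: mult.assoc)
    also have "\<dots> = (CLINT m|measure_pmf (map_pmf (\<lambda>Z. Z h) (Pi_pmf (H_set d L) 0 ?p)). iexp (t * real h) ^ m)"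
      by simp
    also have "map_pmf (\<lambda>Z. Z h) (Pi_pmf (H_set d L) 0 ?p) = ?p h"
      using h by (simp add: Pi_pmf_component[OF fin])
    also have "(CLINT m|measure_pmf (?p h). iexp (t * real h) ^ m) = exp (of_real (1 / (real L * real h)) * (iexp (t * real h) - 1))"
      using rate by (intro integral_poisson_power) auto
    also have "of_real (1 / (real L * real h)) * (iexp (t * real h) - 1) = (iexp (t * real h) - 1) / of_nat (L * h)"
      by simp
    finally show "char (distr ?P borel (\<lambda>Z. real h * real (Z h))) t = exp ((iexp (t * real h) - 1) / of_nat (L * h))" .
  qed
  also have "\<dots> = exp (\<Sum>h\<in>H_set d L. (iexp (t * real h) - 1) / of_nat (L * h))"
    by (rule exp_sum[OF fin, symmetric])
  finally show ?thesis .
qed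

text \<open>By Levy's continuity theorem it suffices to treat characteristic functions. The cycle
  count is a sum over the cycles of \<open>word_act \<sigma> v\<close>, so its exponential is a
  product over them, whose mean has a known limit.\<close>

lemma cycle_count_law_converges:
  assumes u: "primitive k u" and dL: "d > 0" "L > 0"
  shows "weak_conv_m (cycle_count_law k (u [^]\<^bsub>free_group k\<^esub> d) L) (limit_law d L)"
proof (rule levy_continuity)
  fix t
  obtain c v where u_eq: "u = c @ v @ inv_word c" and v: "cyclically_reduced v" "\<not> proper_power v"
    and set_u: "set u \<subseteq> {1..k} \<times> UNIV"
    using primitive_cyclic_reduction[OF u] by blast
  have set_v: "set v \<subseteq> {1..k} \<times> UNIV" using set_u by (simp add: u_eq)
  have uc: "u \<in> carrier (free_group k)" using u by (simp add: primitive_def)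
  define S where "S = (\<lambda>h. L * h) ` H_set d L"
  \<comment> \<open>A cycle of length \<open>m = L * h\<close> contributes \<open>h\<close> cycles,
    hence the factor \<open>iexp (t * real h)\<close>; writing \<open>h\<close> as
    \<open>m / L\<close> expresses it through \<open>m\<close> alone.\<close>
  define \<zeta> where "\<zeta> m = iexp (t * (real m / real L)) - 1" for m :: nat
  have fin: "finite (H_set d L)" using dL(1) by (rule finite_H_set)
  have inj: "inj_on (\<lambda>h. L * h) (H_set d L)" using dL(2) by (auto simp: inj_on_def)
  have S: "finite S" "0 \<notin> S" using fin dL by (auto simp: S_def H_set_def)
  have \<zeta>_L: "\<zeta> (L * h) = iexp (t * real h) - 1" for h using dL by (simp add: \<zeta>_def)
  have "iexp (t * real (cycle_count (u [^]\<^bsub>free_group k\<^esub> d) L n \<sigma>)) =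
      (\<Prod>C\<in>cycles_in n (word_act \<sigma> v) S. 1 + \<zeta> (card C))" if "\<sigma> \<in> perm_tuples k n" for \<sigma> n
  proof -
    have "(\<Prod>C\<in>cycles_in n (word_act \<sigma> v) S. 1 + \<zeta> (card C)) =
        (\<Prod>m\<in>S. (1 + \<zeta> m) ^ num_cycles n m (word_act \<sigma> v))"
      by (rule prod_cycles_in[OF S(1)])
    also have "\<dots> = (\<Prod>h\<in>H_set d L. iexp (t * real h) ^ num_cycles n (L * h) (word_act \<sigma> v))"
      unfolding S_def by (simp add: prod.reindex[OF inj] \<zeta>_L)
    also have "\<dots> = (\<Prod>h\<in>H_set d L. iexp (t * real (h * num_cycles n (L * h) (word_act \<sigma> v))))"
      by (simp only: iexp_of_nat_mult[symmetric] of_nat_mult mult.assoc)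
    also have "\<dots> = iexp (t * real (\<Sum>h\<in>H_set d L. h * num_cycles n (L * h) (word_act \<sigma> v)))"
      by (simp only: exp_sum[OF fin, symmetric] sum_distrib_left[symmetric] of_real_sum[symmetric] of_nat_sum[symmetric])
    finally show ?thesis
      by (simp only: cycle_count_power[OF that uc u_eq dL])
  qed
  then have "char (cycle_count_law k (u [^]\<^bsub>free_group k\<^esub> d) L n) t =
      perm_mean k n (\<lambda>\<sigma>. \<Prod>C\<in>cycles_in n (word_act \<sigma> v) S. 1 + \<zeta> (card C))" for n
    unfolding char_cycle_count_law by (rule perm_mean_cong)
  moreover have "(\<Sum>m\<in>S. \<zeta> m / of_nat m) = (\<Sum>h\<in>H_set d L. (iexp (t * real h) - 1) / of_nat (L * h))"
    unfolding S_def by (simp only: sum.reindex[OF inj] comp_def \<zeta>_L)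
  moreover have "(\<lambda>n. perm_mean k n (\<lambda>\<sigma>. \<Prod>C\<in>cycles_in n (word_act \<sigma> v) S. 1 + \<zeta> (card C)))
      \<longlonglongrightarrow> exp (\<Sum>m\<in>S. \<zeta> m / of_nat m)"
    by (rule perm_mean_prod_cycles[OF v set_v S]) (simp add: \<zeta>_def)
  ultimately show "(\<lambda>n. char (cycle_count_law k (u [^]\<^bsub>free_group k\<^esub> d) L n) t) \<longlonglongrightarrow> char (limit_law d L) t"
    by (simp only: char_limit_law[OF dL])
qed (rule real_distribution_cycle_count_law real_distribution_limit_law)+

text \<open>Turns convergence to \<open>limit_law d L\<close> into a description of all weak
  limits.\<close>

lemma weak_limit_unique:
  assumes "\<And>n. real_distribution (M n)" "real_distribution \<mu>" "real_distribution \<nu>"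
    and "weak_conv_m M \<mu>" "weak_conv_m M \<nu>"
  shows "\<mu> = \<nu>"
proof (rule Levy_uniqueness)
  show "char \<mu> = char \<nu>"
    using levy_continuity1[OF assms(1,2,4)] levy_continuity1[OF assms(1,3,5)] LIMSEQ_unique by blast
qed (use assms in auto)

text \<open>Dependence on \<open>d\<close> and \<open>L\<close> alone is rendered by comparing two
  words, possibly in free groups of different rank, that share these numbers: their laws have the
  same weak limits.\<close>

theorem theorem2:
  fixes k d L :: nat and w u :: "letter list"
  assumes "w \<in> carrier (free_group k)" and "w \<noteq> \<one>\<^bsub>free_group k\<^esub>"
    and "primitive k u" and "d \<ge> 1" and "w = u [^]\<^bsub>free_group k\<^esub> d"
    and "L \<ge> 1"
  shows "weak_conv_m (cycle_count_law k w L) (limit_law d L) \<and>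
    (\<forall>k' w' u'. w' \<in> carrier (free_group k') \<longrightarrow> w' \<noteq> \<one>\<^bsub>free_group k'\<^esub> \<longrightarrow>
       primitive k' u' \<longrightarrow> w' = u' [^]\<^bsub>free_group k'\<^esub> d \<longrightarrow>
       (\<forall>\<mu>. real_distribution \<mu> \<longrightarrow>
          (weak_conv_m (cycle_count_law k w L) \<mu> \<longleftrightarrow>
           weak_conv_m (cycle_count_law k' w' L) \<mu>)))"
proof -
  have conv: "weak_conv_m (cycle_count_law k' (u' [^]\<^bsub>free_group k'\<^esub> d) L) (limit_law d L)"
    if "primitive k' u'" for k' u'
    using that assms by (intro cycle_count_law_converges) auto
  \<comment> \<open>Both sides of the claimed equivalence reduce to
    \<open>\<mu> = limit_law d L\<close>.\<close>
  have "weak_conv_m (cycle_count_law k' (u' [^]\<^bsub>free_group k'\<^esub> d) L) \<mu> \<longleftrightarrow> \<mu> = limit_law d L"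
    if "primitive k' u'" "real_distribution \<mu>" for k' u' \<mu>
    using conv[OF that(1)] that(2) weak_limit_unique[where M = "cycle_count_law k' (u' [^]\<^bsub>free_group k'\<^esub> d) L",
        OF real_distribution_cycle_count_law that(2) real_distribution_limit_law]
    by blast
  then show ?thesis using conv assms by simp
qed

end
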